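(* Let $t>0$. Let $X=\bigsqcup_{n\in\mathbb N}X_n$ and $Y=\bigsqcup_{n\in\mathbb N}Y_n$ be u.l.f. metric spaces which are coarse disjoint unions of finite nonempty $t$-connected metric spaces. If the uniform Roe algebras $\mathrm C^*_u(X)$ and $\mathrm C^*_u(Y)$ are isomorphic (as $\mathrm C^*$-algebras), then there are cofinite subsets $N,M\subseteq\mathbb N$, a bijection $i\colon N\to M$, and a coarse equivalence $f\colon X\to Y$ such that \[\sum_{n\in\mathbb N\setminus N}|X_n|=\sum_{n\in\mathbb N\setminus M}|Y_n|\] and \[|X_n|=|Y_{i(n)}|\quad\text{and}\quad f(X_n)\subseteq Y_{i(n)}\quad\text{for all }n\in N.\]
   Context: A metric space is uniformly locally finite (u.l.f.) if for each $r>0$ there is a uniform bound on the cardinality of its balls of radius $r$. For a u.l.f. metric space $(X,d_X)$, let $(\delta_x)_{x\in X}$ be the standard orthonormal basis of the complex Hilbert space $\ell_2(X)$. The propagation of $a\in\mathcal B(\ell_2(X))$ is $\mathrm{prop}(a)=\sup\{d_X(x,z)\mid\langle a\delta_x,\delta_z\rangle\ne0\}$. The uniform Roe algebra $\mathrm C^*_u(X)$ is the norm closure of the set of all operators in $\mathcal B(\ell_2(X))$ with finite propagation. A metric space $(X,d_X)$ is $t$-connected if for all $x,y\in X$ there are $x_0,\dots,x_n\in X$ with $x=x_0$, $y=x_n$ and $d_X(x_{i-1},x_i)\le t$ for all $i\in\{1,\dots,n\}$. A coarse disjoint union of a sequence $(X_n)_{n\in\mathbb N}$ of finite metric spaces is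 the disjoint union $\bigsqcup_nX_n$ equipped with any metric $d$ that restricts to the given metric on each $X_n$ and satisfies $d(X_n,X_m)\to\infty$ as $(n,m)\to\infty$ in $\{(n,m)\in\mathbb N^2\mid n\ne m\}$ (i.e., for each $R$, $d(X_n,X_m)>R$ for all but finitely many pairs $n\neq m$). Two maps $f,g\colon X\to(Y,d_Y)$ from a set into a metric space are close if $\sup_{x\in X}d_Y(f(x),g(x))<\infty$. A map $f\colon(X,d_X)\to(Y,d_Y)$ between metric spaces is coarse if for all $r>0$ there is $s>0$ such that $d_X(x,z)<r$ implies $d_Y(f(x),f(z))<s$. A coarse map $f\colon X\to Y$ is a coarse equivalence if there is a coarse map $g\colon Y\to X$ such that $g\circ f$ and $f\circ g$ are close to the respective identity maps. *)

theory Defs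
  imports "HOL-Analysis.Analysis"
begin

section \<open>The complex Hilbert space of square-summable functions\<close>

typedef 'a ell2 = "{f :: 'a \<Rightarrow> complex. (\<lambda>x. (cmod (f x))\<^sup>2) summable_on UNIV}"
  morphisms ell2_fun Abs_ell2
  by (rule exI[of _ "\<lambda>_. 0"]) simp

setup_lifting type_definition_ell2

lemma square_summable: "(\<lambda>x. (cmod (ell2_fun f x))\<^sup>2) summable_on UNIV"
  using ell2_fun by blast

lemma square_summable_add:
  fixes f g :: "'a \<Rightarrow> complex"
  assumes "(\<lambda>x. (cmod (f x))\<^sup>2) summable_on UNIV" "(\<lambda>x. (cmod (g x))\<^sup>2) summable_on UNIV"
  shows "(\<lambda>x. (cmod (f x + g x))\<^sup>2) summable_on UNIV"
proof -
  have 1: "(\<lambda>x. 2 * (cmod (f x))\<^sup>2 + 2 * (cmod (g x))\<^sup>2) summable_on UNIV"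
    by (intro summable_on_add summable_on_cmult_right assms)
  have 2: "norm ((cmod (f x + g x))\<^sup>2) \<le> 2 * (cmod (f x))\<^sup>2 + 2 * (cmod (g x))\<^sup>2" for x
  proof -
    have "(cmod (f x + g x))\<^sup>2 \<le> (cmod (f x) + cmod (g x))\<^sup>2"
      by (intro power_mono norm_triangle_ineq) simp
    also have "\<dots> \<le> 2 * (cmod (f x))\<^sup>2 + 2 * (cmod (g x))\<^sup>2"
      using sum_squares_bound[of "cmod (f x)" "cmod (g x)"] by (simp add: power2_sum)
    finally show ?thesis by simp
  qed
  show ?thesis
    using Infinite_Sum.abs_summable_on_comparison_test'[OF 1 2] by simp
qed

lemma square_summable_mult:
  fixes f :: "'a \<Rightarrow> complex"
  assumes "(\<lambda>x. (cmod (f x))\<^sup>2) summable_on UNIV"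
  shows "(\<lambda>x. (cmod (c * f x))\<^sup>2) summable_on UNIV"
  unfolding norm_mult power_mult_distrib by (intro summable_on_cmult_right assms)

lemma inner_ell2_summable:
  "(\<lambda>x. inner (ell2_fun f x) (ell2_fun g x)) summable_on UNIV"
proof -
  have 1: "(\<lambda>x. (cmod (ell2_fun f x))\<^sup>2 + (cmod (ell2_fun g x))\<^sup>2) summable_on UNIV"
    by (intro summable_on_add square_summable)
  have 2: "norm (inner (ell2_fun f x) (ell2_fun g x))
      \<le> (cmod (ell2_fun f x))\<^sup>2 + (cmod (ell2_fun g x))\<^sup>2" for x
  proof -
    have "norm (inner (ell2_fun f x) (ell2_fun g x)) \<le> cmod (ell2_fun f x) * cmod (ell2_fun g x)"
      by (simp add: Cauchy_Schwarz_ineq2)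
    also have "\<dots> \<le> (cmod (ell2_fun f x))\<^sup>2 + (cmod (ell2_fun g x))\<^sup>2"
      using sum_squares_bound[of "cmod (ell2_fun f x)" "cmod (ell2_fun g x)"]
        mult_nonneg_nonneg[OF norm_ge_zero[of "ell2_fun f x"] norm_ge_zero[of "ell2_fun g x"]]
      by linarith
    finally show ?thesis .
  qed
  show ?thesis
    using Infinite_Sum.abs_summable_on_comparison_test'[OF 1 2] by (rule abs_summable_summable)
qed

instantiation ell2 :: (type) real_vector
begin

lift_definition zero_ell2 :: "'a ell2" is "\<lambda>_. 0" by simp

lift_definition plus_ell2 :: "'a ell2 \<Rightarrow> 'a ell2 \<Rightarrow> 'a ell2" is "\<lambda>f g x. f x + g x"
  by (rule square_summable_add)

lift_definition uminus_ell2 :: "'a ell2 \<Rightarrow> 'a ell2" is "\<lambda>f x. - f x" by simp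

lift_definition minus_ell2 :: "'a ell2 \<Rightarrow> 'a ell2 \<Rightarrow> 'a ell2" is "\<lambda>f g x. f x - g x"
  subgoal for f g using square_summable_add[of f "\<lambda>x. - g x"] by simp
  done

lift_definition scaleR_ell2 :: "real \<Rightarrow> 'a ell2 \<Rightarrow> 'a ell2" is "\<lambda>r f x. r *\<^sub>R f x"
  unfolding scaleR_conv_of_real by (rule square_summable_mult)

instance
proof
  fix f g h :: "'a ell2" and r s :: real
  show "f + g + h = f + (g + h)" "f + g = g + f" "0 + f = f" "- f + f = 0" "f - g = f + - g"
    "r *\<^sub>R (f + g) = r *\<^sub>R f + r *\<^sub>R g" "(r + s) *\<^sub>R f = r *\<^sub>R f + s *\<^sub>R f"
    "r *\<^sub>R s *\<^sub>R f = (r * s) *\<^sub>R f" "1 *\<^sub>R f = f"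
    by (transfer; simp add: algebra_simps)+
qed

end

text \<open>The real inner product below is the real part of the complex one, so that it induces the
  usual norm.\<close>

instantiation ell2 :: (type) real_inner
begin

definition inner_ell2 :: "'a ell2 \<Rightarrow> 'a ell2 \<Rightarrow> real" where
  "inner_ell2 f g = (\<Sum>\<^sub>\<infinity>x. inner (ell2_fun f x) (ell2_fun g x))"

definition norm_ell2 :: "'a ell2 \<Rightarrow> real" where
  "norm_ell2 f = sqrt (\<Sum>\<^sub>\<infinity>x. (cmod (ell2_fun f x))\<^sup>2)"

definition dist_ell2 :: "'a ell2 \<Rightarrow> 'a ell2 \<Rightarrow> real" where
  "dist_ell2 f g = norm (f - g)"

definition sgn_ell2 :: "'a ell2 \<Rightarrow> 'a ell2" where
  "sgn_ell2 f = f /\<^sub>R norm f"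

definition uniformity_ell2 :: "('a ell2 \<times> 'a ell2) filter" where
  "uniformity_ell2 = (INF e\<in>{0<..}. principal {(f, g). dist f g < e})"

definition open_ell2 :: "'a ell2 set \<Rightarrow> bool" where
  "open_ell2 U = (\<forall>f\<in>U. \<forall>\<^sub>F (f', g) in uniformity. f' = f \<longrightarrow> g \<in> U)"

instance
proof
  fix f g h :: "'a ell2" and r :: real
  show "dist f g = norm (f - g)" by (rule dist_ell2_def)
  show "sgn f = f /\<^sub>R norm f" by (rule sgn_ell2_def)
  show "uniformity = (INF e\<in>{0<..}. principal {(f :: 'a ell2, g). dist f g < e})"
    by (rule uniformity_ell2_def)
  show "open U = (\<forall>f\<in>U. \<forall>\<^sub>F (f', g) in uniformity. f' = f \<longrightarrow> g \<in> U)" for U :: "'a ell2 set"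
    by (rule open_ell2_def)
  show "inner f g = inner g f"
    by (simp add: inner_ell2_def inner_commute)
  show "inner (f + g) h = inner f h + inner g h"
    unfolding inner_ell2_def plus_ell2.rep_eq inner_add_left
    by (intro infsum_add inner_ell2_summable)
  show "inner (r *\<^sub>R f) g = r * inner f g"
    unfolding inner_ell2_def scaleR_ell2.rep_eq inner_scaleR_left
    by (rule infsum_cmult_right')
  show "0 \<le> inner f f"
    unfolding inner_ell2_def by (intro infsum_nonneg) simp
  show "norm f = sqrt (inner f f)"
    by (simp add: norm_ell2_def inner_ell2_def power2_norm_eq_inner)
  show "inner f f = 0 \<longleftrightarrow> f = 0"
  proof
    assume "inner f f = 0"
    then have "inner (ell2_fun f x) (ell2_fun f x) = 0" for x
      unfolding inner_ell2_def
      by (intro nonneg_infsum_le_0D[where A = UNIV] inner_ell2_summable) auto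
    then have "ell2_fun f = ell2_fun 0" by (auto simp: zero_ell2.rep_eq)
    then show "f = 0" by (simp add: ell2_fun_inject)
  qed (simp add: inner_ell2_def zero_ell2.rep_eq)
qed

end

text \<open>Linear in the first argument.\<close>

definition cinner :: "'a ell2 \<Rightarrow> 'a ell2 \<Rightarrow> complex" where
  "cinner f g = (\<Sum>\<^sub>\<infinity>x. ell2_fun f x * cnj (ell2_fun g x))"

lift_definition scaleC :: "complex \<Rightarrow> 'a ell2 \<Rightarrow> 'a ell2" is "\<lambda>c f x. c * f x"
  by (rule square_summable_mult)

lift_definition delta :: "'a \<Rightarrow> 'a ell2" is "\<lambda>x y. if y = x then 1 else 0"
proof -
  fix x :: 'a
  have "(\<lambda>y. (cmod (if y = x then 1 else 0))\<^sup>2) summable_on {x}" by simp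
  then show "(\<lambda>y. (cmod (if y = x then 1 else 0))\<^sup>2) summable_on UNIV"
    by (rule summable_on_cong_neutral[THEN iffD1, rotated -1]) auto
qed

lemma norm_scaleC: "norm (scaleC c f) = cmod c * norm f"
  by (simp add: norm_ell2_def scaleC.rep_eq norm_mult power_mult_distrib infsum_cmult_right'
      real_sqrt_mult)

lemma bounded_linear_scaleC: "bounded_linear (scaleC c)"
proof (rule bounded_linear_intro[where K = "cmod c"])
  show "scaleC c (f + g) = scaleC c f + scaleC c g" for f g :: "'a ell2"
    by transfer (simp add: algebra_simps)
  show "scaleC c (r *\<^sub>R f) = r *\<^sub>R scaleC c f" for r and f :: "'a ell2"
    by transfer (simp add: algebra_simps)
qed (simp add: norm_scaleC)

section \<open>Bounded operators\<close>

text \<open>Elements of \<open>'a op\<close> are only required to be real-linear; the bounded operators of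
  the complex Hilbert space are those in \<open>bounded_ops\<close>. The norm of \<open>'a op\<close> is the
  operator norm.\<close>

type_synonym 'a op = "'a ell2 \<Rightarrow>\<^sub>L 'a ell2"

definition bounded_ops :: "'a op set" where
  "bounded_ops = {a. \<forall>c f. blinfun_apply a (scaleC c f) = scaleC c (blinfun_apply a f)}"

definition op_scaleC :: "complex \<Rightarrow> 'a op \<Rightarrow> 'a op" where
  "op_scaleC c a = Blinfun (\<lambda>f. scaleC c (blinfun_apply a f))"

lemma op_scaleC_apply: "blinfun_apply (op_scaleC c a) f = scaleC c (blinfun_apply a f)"
  unfolding op_scaleC_def
  by (subst bounded_linear_Blinfun_apply)
    (intro bounded_linear_compose[OF bounded_linear_scaleC] blinfun.bounded_linear_right, simp)

text \<open>For \<open>a \<in> bounded_ops\<close> the operator described here exists and is unique by the Riesz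
  representation theorem.\<close>

definition adjoint_op :: "'a op \<Rightarrow> 'a op" where
  "adjoint_op a =
    (THE b. b \<in> bounded_ops \<and> (\<forall>f g. cinner (blinfun_apply a f) g = cinner f (blinfun_apply b g)))"

text \<open>A \<open>*\<close>-isomorphism between \<open>*\<close>-subalgebras of bounded operators.\<close>

definition star_isomorphism :: "'a op set \<Rightarrow> 'b op set \<Rightarrow> ('a op \<Rightarrow> 'b op) \<Rightarrow> bool" where
  "star_isomorphism A B \<phi> \<longleftrightarrow>
     bij_betw \<phi> A B \<and>
     (\<forall>a\<in>A. \<forall>b\<in>A. \<phi> (a + b) = \<phi> a + \<phi> b) \<and>
     (\<forall>c. \<forall>a\<in>A. \<phi> (op_scaleC c a) = op_scaleC c (\<phi> a)) \<and>
     (\<forall>a\<in>A. \<forall>b\<in>A. \<phi> (a o\<^sub>L b) = \<phi> a o\<^sub>L \<phi> b) \<and>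
     (\<forall>a\<in>A. \<phi> (adjoint_op a) = adjoint_op (\<phi> a))"

definition star_isomorphic :: "'a op set \<Rightarrow> 'b op set \<Rightarrow> bool" where
  "star_isomorphic A B \<longleftrightarrow> (\<exists>\<phi>. star_isomorphism A B \<phi>)"

section \<open>Uniform Roe algebras\<close>

text \<open>The supremum is taken in \<open>ennreal\<close>, so the propagation of \<open>0\<close> is \<open>0\<close>.\<close>

definition propagation :: "'a::metric_space op \<Rightarrow> ennreal" where
  "propagation a =
    (SUP (x, z) \<in> {(x, z). cinner (blinfun_apply a (delta x)) (delta z) \<noteq> 0}. ennreal (dist x z))"

definition uniform_Roe_algebra :: "'a::metric_space op set" where
  "uniform_Roe_algebra = closure {a \<in> bounded_ops. propagation a < \<infinity>}"

section \<open>Coarse geometry\<close>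

definition uniformly_locally_finite :: "'a::metric_space set \<Rightarrow> bool" where
  "uniformly_locally_finite S \<longleftrightarrow>
    (\<forall>r>0. \<exists>k. \<forall>x\<in>S. finite (S \<inter> cball x r) \<and> card (S \<inter> cball x r) \<le> k)"

definition t_connected :: "real \<Rightarrow> 'a::metric_space set \<Rightarrow> bool" where
  "t_connected t S \<longleftrightarrow>
    (\<forall>x\<in>S. \<forall>y\<in>S. \<exists>(n :: nat) p. (\<forall>i\<le>n. p i \<in> S) \<and> p 0 = x \<and> p n = y \<and>
       (\<forall>i\<in>{1..n}. dist (p (i - 1)) (p i) \<le> t))"

text \<open>The metric space \<open>'a\<close> is a coarse disjoint union of its finite subspaces \<open>X n\<close>.\<close>

definition coarse_disjoint_union :: "(nat \<Rightarrow> 'a::metric_space set) \<Rightarrow> bool" where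
  "coarse_disjoint_union X \<longleftrightarrow>
    (\<forall>n. finite (X n)) \<and> disjoint_family X \<and> (\<Union>n. X n) = UNIV \<and>
    (\<forall>R. finite {(n, m). n \<noteq> m \<and> \<not> setdist (X n) (X m) > R})"

definition close_maps :: "('a \<Rightarrow> 'b::metric_space) \<Rightarrow> ('a \<Rightarrow> 'b) \<Rightarrow> bool" where
  "close_maps f g \<longleftrightarrow> bdd_above (range (\<lambda>x. dist (f x) (g x)))"

definition coarse_map :: "('a::metric_space \<Rightarrow> 'b::metric_space) \<Rightarrow> bool" where
  "coarse_map f \<longleftrightarrow> (\<forall>r>0. \<exists>s>0. \<forall>x z. dist x z < r \<longrightarrow> dist (f x) (f z) < s)"

definition coarse_equivalence :: "('a::metric_space \<Rightarrow> 'b::metric_space) \<Rightarrow> bool" where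
  "coarse_equivalence f \<longleftrightarrow>
    coarse_map f \<and> (\<exists>g. coarse_map g \<and> close_maps (g \<circ> f) id \<and> close_maps (f \<circ> g) id)"

end

theory Submission
  imports Defs
begin

text \<open>An isomorphism is implemented by a unitary \<open>U\<close> from \<open>\<ell>\<^sub>2(X)\<close> to \<open>\<ell>\<^sub>2(Y)\<close> with inverse \<open>V\<close>,
  and a Baire category argument shows that the operators \<open>U \<chi>\<^sub>A V\<close> are quasi-local
  uniformly in \<open>A \<subseteq> X\<close>. Choosing signs for the entries of \<open>U \<delta>\<^sub>x\<close> turns this uniformity
  (applied to \<open>V \<chi>\<^sub>B U\<close>) into a lower bound for \<open>max\<^sub>y |\<langle>U \<delta>\<^sub>x, \<delta>\<^sub>y\<rangle>|\<close> that does not depend on \<open>x\<close>;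
  a map \<open>f\<close> that selects such a \<open>y\<close>, and the analogous \<open>g\<close> for \<open>V\<close>, are mutually inverse coarse
  equivalences, and \<open>U \<delta>\<^sub>x\<close> is concentrated near \<open>f x\<close>.

  The cardinalities come from a dimension count. Let \<open>A \<subseteq> X\<close> and \<open>B \<subseteq> Y\<close> be finite, let \<open>B\<close> be
  far from its complement and let \<open>f\<close> map \<open>A\<close> into \<open>B\<close>. If \<open>|A| > |B|\<close>, some nonzero \<open>v\<close> supported
  on \<open>A\<close> satisfies \<open>\<chi>\<^sub>B U v = 0\<close>; by quasi-locality \<open>\<chi>\<^sub>B U\<close> stays small on every change of signs of
  \<open>v\<close>, although for suitable signs its norm is at least that of an average, which is large because
  each \<open>U \<delta>\<^sub>x\<close> with \<open>x \<in> A\<close> lives almost entirely on \<open>B\<close>. This applies to the matched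
  pieces, and also to the union of the finitely many unmatched ones.\<close>

section \<open>Coordinate projections and the complex inner product\<close>

lift_definition proj :: "'a set \<Rightarrow> 'a ell2 \<Rightarrow> 'a ell2" is "\<lambda>A f x. if x \<in> A then f x else 0"
proof -
  fix A :: "'a set" and f :: "'a \<Rightarrow> complex"
  assume *: "(\<lambda>x. (cmod (f x))\<^sup>2) summable_on UNIV"
  show "(\<lambda>x. (cmod (if x \<in> A then f x else 0))\<^sup>2) summable_on UNIV"
    using summable_on_subset_banach[OF *, of A]
    by (rule summable_on_cong_neutral[THEN iffD1, rotated -1]) auto
qed

lemma ell2_eqI: "(\<And>x. ell2_fun f x = ell2_fun g x) \<Longrightarrow> f = g"
  by (simp add: ell2_fun_inject[symmetric] ext)

lemmas ell2_simps [simp] = zero_ell2.rep_eq plus_ell2.rep_eq uminus_ell2.rep_eq minus_ell2.rep_eq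
  scaleR_ell2.rep_eq scaleC.rep_eq proj.rep_eq

lemma ell2_fun_delta [simp]: "ell2_fun (delta x) y = (if y = x then 1 else 0)"
  by (simp add: delta.rep_eq)

lemma proj_add: "proj A (f + g) = proj A f + proj A g"
  and proj_diff: "proj A (f - g) = proj A f - proj A g"
  and proj_scaleC: "proj A (scaleC c f) = scaleC c (proj A f)"
  and proj_scaleR: "proj A (r *\<^sub>R f) = r *\<^sub>R proj A f"
  and proj_proj [simp]: "proj A (proj B f) = proj (A \<inter> B) f"
  and proj_empty [simp]: "proj {} f = 0"
  and proj_UNIV [simp]: "proj UNIV f = f"
  and proj_decomp: "proj A f + proj (- A) f = f"
  and proj_singleton: "proj {x} f = scaleC (ell2_fun f x) (delta x)"
  by (auto intro!: ell2_eqI)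

lemma proj_Un_disjoint: "A \<inter> B = {} \<Longrightarrow> proj (A \<union> B) f = proj A f + proj B f"
  by (auto intro!: ell2_eqI)

lemma proj_finite: "finite F \<Longrightarrow> proj F f = (\<Sum>x\<in>F. scaleC (ell2_fun f x) (delta x))"
proof (induction F rule: finite_induct)
  case (insert x F)
  then have "proj (insert x F) f = proj {x} f + proj F f"
    by (subst proj_Un_disjoint[symmetric]) auto
  with insert show ?case by (simp add: proj_singleton)
qed simp

lemma ell2_fun_sum_delta:
  assumes "finite F"
  shows "ell2_fun (\<Sum>x\<in>F. scaleC (c x) (delta x)) z = (if z \<in> F then c z else 0)"
  using assms by (induction F rule: finite_induct) auto

lemma scaleC_add: "scaleC c (f + g) = scaleC c f + scaleC c g"
  and scaleC_add_left: "scaleC (c + d) f = scaleC c f + scaleC d f"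
  and scaleC_scaleC [simp]: "scaleC c (scaleC d f) = scaleC (c * d) f"
  and scaleC_one [simp]: "scaleC 1 f = f"
  and scaleR_scaleC: "r *\<^sub>R f = scaleC (complex_of_real r) f"
  by (auto intro!: ell2_eqI simp: algebra_simps scaleR_conv_of_real)

section \<open>Norms of restrictions: Pythagoras and small tails\<close>

lemma norm_ell2_power2: "(norm f)\<^sup>2 = (\<Sum>\<^sub>\<infinity>x. (cmod (ell2_fun f x))\<^sup>2)"
  unfolding norm_ell2_def by (simp add: infsum_nonneg)

lemma inner_proj_Compl: "inner (proj A f) (proj (- A) g) = 0"
  unfolding inner_ell2_def by (rule infsum_0) auto

lemma norm_proj_Pythagoras: "(norm f)\<^sup>2 = (norm (proj A f))\<^sup>2 + (norm (proj (- A) f))\<^sup>2"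
  using norm_add_Pythagorean[of "proj A f" "proj (- A) f"]
  by (simp add: orthogonal_def inner_proj_Compl proj_decomp)

lemma norm_proj_le: "norm (proj A f) \<le> norm f"
proof -
  have "(norm (proj A f))\<^sup>2 \<le> (norm f)\<^sup>2"
    using norm_proj_Pythagoras[of f A] by simp
  then show ?thesis by (rule power2_le_imp_le) simp
qed

lemma norm_proj_mono: "A \<subseteq> B \<Longrightarrow> norm (proj A f) \<le> norm (proj B f)"
  using norm_proj_le[of A "proj B f"] by (simp add: Int_absorb2)

lemma norm_proj_finite: "finite F \<Longrightarrow> (norm (proj F f))\<^sup>2 = (\<Sum>x\<in>F. (cmod (ell2_fun f x))\<^sup>2)"
  unfolding norm_ell2_power2
  by (subst infsum_finite[symmetric], assumption, rule infsum_cong_neutral) auto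

lemma norm_proj_tail:
  assumes "e > 0"
  obtains F where "finite F" "norm (proj (- F) f) < e"
proof -
  have "((\<lambda>x. (cmod (ell2_fun f x))\<^sup>2) has_sum (norm f)\<^sup>2) UNIV"
    unfolding norm_ell2_power2 by (intro has_sum_infsum square_summable)
  then have "\<forall>\<^sub>F F in finite_subsets_at_top UNIV.
      dist (\<Sum>x\<in>F. (cmod (ell2_fun f x))\<^sup>2) ((norm f)\<^sup>2) < e\<^sup>2"
    unfolding has_sum_def by (rule tendstoD) (use assms in simp)
  then obtain F where F: "finite F" "dist (\<Sum>x\<in>F. (cmod (ell2_fun f x))\<^sup>2) ((norm f)\<^sup>2) < e\<^sup>2"
    unfolding eventually_finite_subsets_at_top by auto
  then have "(norm (proj (- F) f))\<^sup>2 < e\<^sup>2"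
    using norm_proj_Pythagoras[of f F] norm_proj_finite[OF F(1), of f] by (auto simp: dist_real_def)
  then have "norm (proj (- F) f) < e"
    by (rule power_less_imp_less_base) (use assms in simp)
  with F that show ?thesis by blast
qed

lemma norm_delta [simp]: "norm (delta x) = 1"
proof -
  have "(norm (proj {x} (delta x)))\<^sup>2 = 1"
    by (subst norm_proj_finite) auto
  then show ?thesis by (simp add: proj_singleton power2_eq_1_iff)
      (metis norm_ge_zero neg_0_le_iff_le not_one_le_zero)
qed

lemma cmod_ell2_fun_le: "cmod (ell2_fun f x) \<le> norm f"
  using norm_proj_le[of "{x}" f] by (simp add: proj_singleton norm_scaleC)

lemma cmod_ell2_fun_le_proj: "x \<in> A \<Longrightarrow> cmod (ell2_fun f x) \<le> norm (proj A f)"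
  using cmod_ell2_fun_le[of "proj A f" x] by simp

lemma bounded_linear_proj: "bounded_linear (proj A)"
  by (rule bounded_linear_intro[where K = 1]) (simp_all add: proj_add proj_scaleR norm_proj_le)

text \<open>The imaginary part of \<open>z * cnj w\<close> is the real inner product of
  \<open>z\<close> with \<open>\<i> * w\<close>. Additivity of the complex form is thereby inherited
  from the \<open>real_inner\<close> structure.\<close>

lemma cinner_conv_inner: "cinner f g = Complex (inner f g) (inner f (scaleC \<i> g))"
proof -
  have *: "((\<lambda>x. inner (ell2_fun f x) (ell2_fun h x)) has_sum inner f h) UNIV" for h
    unfolding inner_ell2_def by (intro has_sum_infsum inner_ell2_summable)
  have "((\<lambda>x. complex_of_real (inner (ell2_fun f x) (ell2_fun g x)) +
        \<i> * complex_of_real (inner (ell2_fun f x) (ell2_fun (scaleC \<i> g) x))) has_sum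
      complex_of_real (inner f g) + \<i> * complex_of_real (inner f (scaleC \<i> g))) UNIV"
    by (intro has_sum_add has_sum_cmult_right has_sum_of_real *)
  also have "(\<lambda>x. complex_of_real (inner (ell2_fun f x) (ell2_fun g x)) +
        \<i> * complex_of_real (inner (ell2_fun f x) (ell2_fun (scaleC \<i> g) x))) =
      (\<lambda>x. ell2_fun f x * cnj (ell2_fun g x))"
    by (auto simp: complex_eq_iff inner_complex_def)
  finally show ?thesis
    unfolding cinner_def by (auto simp: complex_eq_iff dest!: infsumI)
qed

lemma cinner_add_left: "cinner (f + g) h = cinner f h + cinner g h"
  and cinner_add_right: "cinner h (f + g) = cinner h f + cinner h g"
  and cinner_diff_right: "cinner h (f - g) = cinner h f - cinner h g"
proof -
  have "scaleC \<i> (f - g) = scaleC \<i> f - scaleC \<i> g"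
    by (auto intro!: ell2_eqI simp: algebra_simps)
  then show "cinner (f + g) h = cinner f h + cinner g h"
    "cinner h (f + g) = cinner h f + cinner h g"
    "cinner h (f - g) = cinner h f - cinner h g"
    by (simp_all add: cinner_conv_inner complex_eq_iff inner_add inner_diff scaleC_add
        inner_diff_left inner_diff_right)
qed

lemma cinner_scaleC_left: "cinner (scaleC c f) g = c * cinner f g"
  unfolding cinner_def by (simp add: infsum_cmult_right' mult.assoc)

lemma cinner_scaleC_right: "cinner f (scaleC c g) = cnj c * cinner f g"
  unfolding cinner_def by (simp add: infsum_cmult_right'[symmetric] ac_simps)

lemma cinner_commute: "cinner f g = cnj (cinner g f)"
  unfolding cinner_def by (simp add: infsum_cnj[symmetric] ac_simps)

lemma Re_cinner: "Re (cinner f g) = inner f g"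
  by (simp add: cinner_conv_inner)

lemma cinner_self: "cinner f f = complex_of_real ((norm f)\<^sup>2)"
proof -
  have "Im (cinner f f) = 0"
    using cinner_commute[of f f] by (metis complex_cnj_cancel_iff cnj.simps(2) add.inverse_neutral
        eq_neg_iff_add_eq_0 double_zero)
  then show ?thesis
    by (simp add: complex_eq_iff Re_cinner power2_norm_eq_inner)
qed

lemma cinner_zero_left [simp]: "cinner 0 f = 0"
  by (simp add: cinner_def)

lemma cmod_cinner_le: "cmod (cinner f g) \<le> norm f * norm g"
proof -
  \<comment> \<open>\<open>c\<close> is a phase that makes the complex product real and nonnegative,
    so that the real Cauchy-Schwarz inequality applies to \<open>scaleC c f\<close>.\<close>
  define c where "c = (if cinner f g = 0 then 1 else cmod (cinner f g) / cinner f g)"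
  have "complex_of_real (cmod (cinner f g)) = c * cinner f g"
    by (simp add: c_def)
  also have "\<dots> = cinner (scaleC c f) g" by (simp add: cinner_scaleC_left)
  finally have "cmod (cinner f g) = inner (scaleC c f) g"
    by (metis Re_cinner Re_complex_of_real)
  also have "\<dots> \<le> norm (scaleC c f) * norm g" by (rule norm_cauchy_schwarz)
  also have "\<dots> \<le> norm f * norm g"
    by (intro mult_right_mono) (auto simp: norm_scaleC c_def norm_divide)
  finally show ?thesis .
qed

lemma cinner_delta_right [simp]: "cinner f (delta x) = ell2_fun f x"
proof -
  have "cinner f (delta x) = (\<Sum>\<^sub>\<infinity>y\<in>{x}. ell2_fun f y)"
    unfolding cinner_def by (rule infsum_cong_neutral) auto
  then show ?thesis by simp
qed

lemma cinner_delta_left [simp]: "cinner (delta x) f = cnj (ell2_fun f x)"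
  by (subst cinner_commute) simp

lemma cinner_proj: "cinner (proj A f) g = cinner f (proj A g)"
  unfolding cinner_def by (rule infsum_cong) auto

lemma cinner_eqI: "(\<And>g. cinner f g = cinner f' g) \<Longrightarrow> f = f'"
  by (rule ell2_eqI) (metis cinner_delta_right)

section \<open>Bounded operators and adjoints\<close>

lemma ell2_of_fun:
  assumes "\<And>F. finite F \<Longrightarrow> (\<Sum>x\<in>F. (cmod (h x))\<^sup>2) \<le> c"
  obtains v where "ell2_fun v = h" "(norm v)\<^sup>2 \<le> c"
proof
  have *: "(\<lambda>x. (cmod (h x))\<^sup>2) summable_on UNIV"
    by (rule nonneg_bdd_above_summable_on) (use assms in \<open>auto intro!: bdd_aboveI\<close>)
  then show 1: "ell2_fun (Abs_ell2 h) = h"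
    by (simp add: Abs_ell2_inverse)
  show "(norm (Abs_ell2 h))\<^sup>2 \<le> c"
    unfolding norm_ell2_power2 1 by (rule infsum_le_finite_sums[OF *]) (use assms in auto)
qed

lemma bounded_op_of_fun:
  fixes H :: "'a ell2 \<Rightarrow> 'a \<Rightarrow> complex"
  assumes add: "\<And>f g x. H (f + g) x = H f x + H g x"
    and scale: "\<And>c f x. H (scaleC c f) x = c * H f x"
    and bound: "\<And>f F. finite F \<Longrightarrow> (\<Sum>x\<in>F. (cmod (H f x))\<^sup>2) \<le> (K * norm f)\<^sup>2"
    and "K \<ge> 0"
  obtains a where "a \<in> bounded_ops" "\<And>f. ell2_fun (blinfun_apply a f) = H f"
proof -
  have "\<exists>v. ell2_fun v = H f \<and> (norm v)\<^sup>2 \<le> (K * norm f)\<^sup>2" for f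
    by (rule ell2_of_fun[OF bound]) auto
  then obtain T where T: "\<And>f. ell2_fun (T f) = H f" "\<And>f. (norm (T f))\<^sup>2 \<le> (K * norm f)\<^sup>2"
    by metis
  have bl: "bounded_linear T"
  proof (rule bounded_linear_intro[where K = K])
    show "T (f + g) = T f + T g" for f g
      by (rule ell2_eqI) (simp add: T add)
    show "T (r *\<^sub>R f) = r *\<^sub>R T f" for r f
      by (rule ell2_eqI) (simp add: T scale scaleR_scaleC)
    show "norm (T f) \<le> norm f * K" for f
      using power2_le_imp_le[OF T(2)[of f]] \<open>K \<ge> 0\<close> by (simp add: mult.commute)
  qed
  show ?thesis
  proof
    show "Blinfun T \<in> bounded_ops"
      by (auto intro!: ell2_eqI simp: bounded_ops_def bounded_linear_Blinfun_apply[OF bl] T scale)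
    show "ell2_fun (blinfun_apply (Blinfun T) f) = H f" for f
      by (simp add: bounded_linear_Blinfun_apply[OF bl] T)
  qed
qed

text \<open>By linearity \<open>L\<close> vanishes on finite truncations of \<open>proj D f\<close>,
  and by boundedness the remaining tail contributes arbitrarily little.\<close>

lemma functional_eq_0:
  fixes L :: "'a ell2 \<Rightarrow> complex"
  assumes add: "\<And>f g. L (f + g) = L f + L g"
    and scale: "\<And>c f. L (scaleC c f) = c * L f"
    and bound: "\<And>f. cmod (L f) \<le> K * norm f"
    and zero: "\<And>x. x \<in> D \<Longrightarrow> L (delta x) = 0"
  shows "L (proj D f) = 0"
proof -
  have L0: "L 0 = 0" using add[of 0 0] by simp
  have fin: "L (proj F f) = 0" if "finite F" "F \<subseteq> D" for F
    unfolding proj_finite[OF that(1)] using that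
    by (induction F rule: finite_induct) (auto simp: L0 add scale zero)
  have "cmod (L (proj D f)) \<le> 0 + e" if "e > 0" for e
  proof -
    define k where "k = e / (\<bar>K\<bar> + 1)"
    have "k > 0" using that by (simp add: k_def)
    then obtain F where F: "finite F" "norm (proj (- F) (proj D f)) < k"
      by (rule norm_proj_tail)
    have "L (proj D f) = L (proj (F \<inter> D) f) + L (proj (- F) (proj D f))"
      using proj_decomp[of F "proj D f"] by (metis add proj_proj)
    also have "L (proj (F \<inter> D) f) = 0"
      by (rule fin) (use F in auto)
    also have "cmod (0 + L (proj (- F) (proj D f))) \<le> K * norm (proj (- F) (proj D f))"
      using bound by simp
    also have "\<dots> \<le> (\<bar>K\<bar> + 1) * k"
      using F by (intro mult_mono) auto
    also have "\<dots> = e" by (simp add: k_def add_nonneg_eq_0_iff)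
    finally show ?thesis by simp
  qed
  then have "cmod (L (proj D f)) \<le> 0" by (rule field_le_epsilon)
  then show ?thesis by simp
qed

lemma adjoint_exists:
  assumes a: "a \<in> bounded_ops"
  obtains b where "b \<in> bounded_ops"
    "\<And>f g. cinner (blinfun_apply a f) g = cinner f (blinfun_apply b g)"
proof -
  have a_scale: "blinfun_apply a (scaleC c f) = scaleC c (blinfun_apply a f)" for c f
    using a by (auto simp: bounded_ops_def)
  define H where "H g x = cinner g (blinfun_apply a (delta x))" for g x
  have bound: "(\<Sum>x\<in>F. (cmod (H g x))\<^sup>2) \<le> (norm a * norm g)\<^sup>2" if F: "finite F" for g F
  proof -
    define S where "S = (\<Sum>x\<in>F. (cmod (H g x))\<^sup>2)"
    \<comment> \<open>Testing \<open>a\<close> on the finite vector \<open>v\<close> gives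
      \<open>cinner (blinfun_apply a v) g = (norm v)\<^sup>2\<close>, whence
      \<open>norm v \<le> norm a * norm g\<close> after cancelling a factor
      \<open>norm v\<close>.\<close>
    define v where "v = (\<Sum>x\<in>F. scaleC (H g x) (delta x))"
    have S0: "S \<ge> 0" by (auto simp: S_def intro: sum_nonneg)
    have v: "ell2_fun v y = (if y \<in> F then H g y else 0)" for y
      unfolding v_def by (rule ell2_fun_sum_delta[OF F])
    have "proj F v = v" by (rule ell2_eqI) (auto simp: v)
    then have "(norm v)\<^sup>2 = S"
      using norm_proj_finite[OF F, of v] by (simp add: v S_def)
    moreover have "cinner (blinfun_apply a v) g = S"
    proof -
      have "cinner (blinfun_apply a v) g = (\<Sum>x\<in>F. H g x * cinner (blinfun_apply a (delta x)) g)"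
        unfolding v_def using F
        by (induction F rule: finite_induct)
          (auto simp: blinfun.add_right a_scale cinner_add_left cinner_scaleC_left)
      also have "\<dots> = S"
        unfolding S_def of_real_sum
        by (rule sum.cong, simp,
            subst cinner_commute) (simp only: H_def complex_norm_square)
      finally show ?thesis .
    qed
    then have "S \<le> norm (blinfun_apply a v) * norm g"
      using cmod_cinner_le[of "blinfun_apply a v" g] S0 by simp
    also have "\<dots> \<le> (norm a * norm v) * norm g"
      by (intro mult_right_mono norm_blinfun) auto
    finally have "(norm v)\<^sup>2 \<le> norm a * norm g * norm v"
      using \<open>(norm v)\<^sup>2 = S\<close> by (simp add: ac_simps)
    then have "norm v \<le> norm a * norm g"
      by (cases "norm v = 0") (auto simp: power2_eq_square)
    then have "(norm v)\<^sup>2 \<le> (norm a * norm g)\<^sup>2"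
      by (intro power_mono) auto
    then show ?thesis using \<open>(norm v)\<^sup>2 = S\<close> by (simp add: S_def)
  qed
  obtain b where b: "b \<in> bounded_ops" "\<And>g. ell2_fun (blinfun_apply b g) = H g"
    by (rule bounded_op_of_fun[of H "norm a"])
      (use bound in \<open>auto simp: H_def cinner_add_left cinner_scaleC_left\<close>)
  have "cinner (blinfun_apply a f) g = cinner f (blinfun_apply b g)" for f g
  proof -
    \<comment> \<open>The defect \<open>L\<close> of the adjoint identity vanishes on basis vectors
      by the choice of \<open>H\<close>.\<close>
    define L where "L f = cinner (blinfun_apply a f) g - cinner f (blinfun_apply b g)" for f
    have "L (proj UNIV f) = 0"
    proof (rule functional_eq_0)
      show "L (h + k) = L h + L k" for h k
        by (simp add: L_def blinfun.add_right cinner_add_left)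
      show "L (scaleC c h) = c * L h" for c h
        by (simp add: L_def a_scale cinner_scaleC_left algebra_simps)
      show "cmod (L h) \<le> (norm a * norm g + norm (blinfun_apply b g)) * norm h" for h
      proof -
        have "cmod (L h) \<le> cmod (cinner (blinfun_apply a h) g) + cmod (cinner h (blinfun_apply b g))"
          unfolding L_def by (rule norm_triangle_ineq4)
        also have "\<dots> \<le> norm a * norm h * norm g + norm h * norm (blinfun_apply b g)"
          by (intro add_mono order.trans[OF cmod_cinner_le] mult_right_mono norm_blinfun) auto
        finally show ?thesis by (simp add: algebra_simps)
      qed
      show "L (delta x) = 0" for x
        unfolding L_def cinner_delta_left b(2) H_def by (subst cinner_commute) simp
    qed
    then show ?thesis by (simp add: L_def)
  qed
  with b(1) that show ?thesis by blast
qed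

lemma adjoint_op_eqI:
  assumes "b \<in> bounded_ops" "\<And>f g. cinner (blinfun_apply a f) g = cinner f (blinfun_apply b g)"
  shows "adjoint_op a = b"
  unfolding adjoint_op_def
proof (rule the_equality)
  fix c assume c: "c \<in> bounded_ops \<and> (\<forall>f g. cinner (blinfun_apply a f) g = cinner f (blinfun_apply c g))"
  show "c = b"
  proof (rule blinfun_eqI, rule cinner_eqI)
    fix g h
    have "cinner h (blinfun_apply c g) = cinner h (blinfun_apply b g)"
      using c assms(2) by metis
    then show "cinner (blinfun_apply c g) h = cinner (blinfun_apply b g) h"
      by (metis cinner_commute)
  qed
qed (use assms in auto)

lemma cinner_adjoint_op:
  assumes "a \<in> bounded_ops"
  shows "cinner (blinfun_apply a f) g = cinner f (blinfun_apply (adjoint_op a) g)"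
proof -
  obtain b where b: "b \<in> bounded_ops"
    "\<And>f g. cinner (blinfun_apply a f) g = cinner f (blinfun_apply b g)"
    using adjoint_exists[OF assms] by blast
  with adjoint_op_eqI[OF b] show ?thesis by simp
qed

section \<open>Elements of the uniform Roe algebra\<close>

text \<open>With a fixed unit vector as second argument these operators form a copy of the Hilbert
  space on which left multiplication by bounded operators acts as application; the unitary is
  recovered from this copy.\<close>

definition rank1 :: "'a ell2 \<Rightarrow> 'a ell2 \<Rightarrow> 'a op" where
  "rank1 f g = Blinfun (\<lambda>h. scaleC (cinner h g) f)"

lemma rank1_apply [simp]: "blinfun_apply (rank1 f g) h = scaleC (cinner h g) f"
proof -
  have "bounded_linear (\<lambda>h. scaleC (cinner h g) f)"
    by (rule bounded_linear_intro[where K = "norm g * norm f"])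
      (simp_all add: cinner_add_left scaleC_add_left scaleR_scaleC cinner_scaleC_left norm_scaleC
        mult.assoc[symmetric] mult_right_mono cmod_cinner_le)
  then show ?thesis by (simp add: rank1_def bounded_linear_Blinfun_apply)
qed

lemma rank1_bounded: "rank1 f g \<in> bounded_ops"
  by (auto simp: bounded_ops_def cinner_scaleC_left)

lemma adjoint_rank1: "adjoint_op (rank1 f g) = rank1 g f"
proof (rule adjoint_op_eqI[OF rank1_bounded])
  show "cinner (blinfun_apply (rank1 f g) h) k = cinner h (blinfun_apply (rank1 g f) k)" for h k
    by (simp add: cinner_scaleC_left cinner_scaleC_right cinner_commute[of f k])
qed

lemma rank1_add: "rank1 (f + g) h = rank1 f h + rank1 g h"
  by (rule blinfun_eqI) (simp add: blinfun.add_left scaleC_add)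

lemma rank1_scaleC: "rank1 (scaleC c f) h = op_scaleC c (rank1 f h)"
  by (rule blinfun_eqI) (simp add: op_scaleC_apply mult.commute)

lemma blinfun_compose_rank1:
  assumes "a \<in> bounded_ops"
  shows "a o\<^sub>L rank1 f g = rank1 (blinfun_apply a f) g"
  by (rule blinfun_eqI) (use assms in \<open>simp add: bounded_ops_def\<close>)

lemma rank1_compose_rank1: "rank1 f g o\<^sub>L rank1 h k = rank1 (scaleC (cinner h g) f) k"
  by (simp add: blinfun_compose_rank1 rank1_bounded)

definition proj_op :: "'a set \<Rightarrow> 'a op" where
  "proj_op A = Blinfun (proj A)"

lemma proj_op_apply [simp]: "blinfun_apply (proj_op A) f = proj A f"
  by (simp add: proj_op_def bounded_linear_Blinfun_apply bounded_linear_proj)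

lemma proj_op_bounded: "proj_op A \<in> bounded_ops"
  by (simp add: bounded_ops_def proj_scaleC)

section \<open>Membership in the uniform Roe algebra\<close>

lemma propagation_finite_iff:
  "propagation a < \<infinity> \<longleftrightarrow>
    (\<exists>R. \<forall>x z. ell2_fun (blinfun_apply a (delta x)) z \<noteq> 0 \<longrightarrow> dist x z \<le> R)"
proof
  assume fin: "propagation a < \<infinity>"
  show "\<exists>R. \<forall>x z. ell2_fun (blinfun_apply a (delta x)) z \<noteq> 0 \<longrightarrow> dist x z \<le> R"
  proof (intro exI allI impI)
    fix x z assume "ell2_fun (blinfun_apply a (delta x)) z \<noteq> 0"
    then have "ennreal (dist x z) \<le> propagation a"
      unfolding propagation_def by (intro SUP_upper2[of "(x, z)"]) auto
    with fin show "dist x z \<le> enn2real (propagation a)"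
      using enn2real_mono by fastforce
  qed
next
  assume "\<exists>R. \<forall>x z. ell2_fun (blinfun_apply a (delta x)) z \<noteq> 0 \<longrightarrow> dist x z \<le> R"
  then obtain R where R: "\<And>x z. ell2_fun (blinfun_apply a (delta x)) z \<noteq> 0 \<Longrightarrow> dist x z \<le> R"
    by blast
  have "propagation a \<le> ennreal R"
    unfolding propagation_def by (rule SUP_least) (auto intro!: ennreal_leI R)
  then show "propagation a < \<infinity>"
    by (metis ennreal_less_top infinity_ennreal_def le_less_trans)
qed

lemma finite_propagation_in_Roe:
  assumes "a \<in> bounded_ops"
    and "\<And>x z. ell2_fun (blinfun_apply a (delta x)) z \<noteq> 0 \<Longrightarrow> dist x z \<le> R"
  shows "a \<in> uniform_Roe_algebra"
  unfolding uniform_Roe_algebra_def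
  by (rule subsetD[OF closure_subset]) (use assms propagation_finite_iff in blast)

lemma proj_op_in_Roe: "proj_op A \<in> uniform_Roe_algebra"
  by (rule finite_propagation_in_Roe[OF proj_op_bounded, of A 0]) (auto split: if_splits)

lemma norm_rank1_le: "norm (rank1 f g) \<le> norm f * norm g"
proof (rule norm_blinfun_bound)
  show "norm (blinfun_apply (rank1 f g) h) \<le> norm f * norm g * norm h" for h
    using mult_left_mono[OF cmod_cinner_le[of h g], of "norm f"] by (simp add: norm_scaleC ac_simps)
qed simp

lemma rank1_diff: "rank1 f g - rank1 f' g' = rank1 (f - f') g + rank1 f' (g - g')"
  by (rule blinfun_eqI, rule ell2_eqI)
    (simp add: blinfun.add_left blinfun.diff_left cinner_diff_right algebra_simps)

text \<open>Truncating both vectors to finite sets leaves finitely many nonzero entries, hence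
  finite propagation; the two tails control the error.\<close>

lemma rank1_in_Roe: "rank1 f g \<in> uniform_Roe_algebra"
  unfolding uniform_Roe_algebra_def closure_approachable
proof (intro allI impI)
  fix e :: real assume "e > 0"
  define k where "k = e / (norm f + norm g + 1)"
  have pos: "norm f + norm g + 1 > 0" by (smt (verit) norm_ge_zero)
  then have "k > 0" using \<open>e > 0\<close> by (simp add: k_def)
  obtain F where F: "finite F" "norm (proj (- F) f) < k" using norm_proj_tail[OF \<open>k > 0\<close>] .
  obtain G where G: "finite G" "norm (proj (- G) g) < k" using norm_proj_tail[OF \<open>k > 0\<close>] .
  define b where "b = rank1 (proj F f) (proj G g)"
  have "dist x z \<le> Max (insert 0 ((\<lambda>(x, z). dist x z) ` (G \<times> F)))"
    if "ell2_fun (blinfun_apply b (delta x)) z \<noteq> 0" for x z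
  proof (rule Max_ge)
    have "x \<in> G" "z \<in> F" using that by (auto simp: b_def split: if_splits)
    then show "dist x z \<in> insert 0 ((\<lambda>(x, z). dist x z) ` (G \<times> F))"
      by (intro insertI2 image_eqI[of _ _ "(x, z)"]) auto
  qed (use F G in auto)
  then have "propagation b < \<infinity>" using propagation_finite_iff by blast
  moreover have "dist b (rank1 f g) < e"
  proof -
    have *: "f - proj F f = proj (- F) f" "g - proj G g = proj (- G) g"
      by (auto intro!: ell2_eqI)
    have "dist b (rank1 f g) = norm (rank1 (proj (- F) f) g + rank1 (proj F f) (proj (- G) g))"
      unfolding b_def by (subst dist_commute) (simp add: dist_norm rank1_diff *)
    also have "\<dots> \<le> norm (proj (- F) f) * norm g + norm (proj F f) * norm (proj (- G) g)"
      by (intro order.trans[OF norm_triangle_ineq] add_mono norm_rank1_le)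
    also have "\<dots> \<le> k * norm g + norm f * k"
      using F G \<open>k > 0\<close> by (intro add_mono mult_mono norm_proj_le) auto
    also have "\<dots> < k * (norm f + norm g + 1)"
      using \<open>k > 0\<close> by (simp add: algebra_simps)
    also have "\<dots> = e" using pos by (simp add: k_def)
    finally show ?thesis .
  qed
  ultimately show "\<exists>y\<in>{a \<in> bounded_ops. propagation a < \<infinity>}. dist y (rank1 f g) < e"
    by (intro bexI[of _ b]) (auto simp: b_def rank1_bounded)
qed

text \<open>The uniform Roe algebra is a closure within real-linear operators; complex linearity, an
  intersection of closed conditions, passes to the limits.\<close>

lemma closed_bounded_ops: "closed (bounded_ops :: 'a op set)"
proof -
  have eq: "(bounded_ops :: 'a op set) =
      (\<Inter>c. \<Inter>f. {a. blinfun_apply a (scaleC c f) = scaleC c (blinfun_apply a f)})"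
    by (auto simp: bounded_ops_def)
  show ?thesis
    unfolding eq
    by (intro closed_INT ballI closed_Collect_eq linear_continuous_on
        bounded_linear_compose[OF bounded_linear_scaleC] blinfun.bounded_linear_left)
qed

lemma Roe_bounded: "a \<in> uniform_Roe_algebra \<Longrightarrow> a \<in> bounded_ops"
  unfolding uniform_Roe_algebra_def
  using closure_minimal[OF _ closed_bounded_ops, of "{a \<in> bounded_ops. propagation a < \<infinity>}"] by auto

section \<open>Quasi-local operators\<close>

text \<open>Propagation at most \<open>s\<close> up to an error \<open>e\<close>. A failure is
  exhibited by one vector and two sets, as the Baire argument needs. \<open>T\<close> is a plain
  function so that conjugates by the unitary fit directly.\<close>

definition quasi_local :: "real \<Rightarrow> real \<Rightarrow> ('a::metric_space ell2 \<Rightarrow> 'a ell2) \<Rightarrow> bool" where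
  "quasi_local e s T \<longleftrightarrow>
    (\<forall>C D f. (\<forall>x\<in>C. \<forall>y\<in>D. s < dist x y) \<longrightarrow> norm (proj C (T (proj D f))) \<le> e * norm f)"

lemma quasi_localD:
  "quasi_local e s T \<Longrightarrow> (\<And>x y. x \<in> C \<Longrightarrow> y \<in> D \<Longrightarrow> s < dist x y) \<Longrightarrow>
    norm (proj C (T (proj D f))) \<le> e * norm f"
  unfolding quasi_local_def by blast

lemma quasi_local_mono: "quasi_local e s T \<Longrightarrow> s \<le> s' \<Longrightarrow> quasi_local e s' T"
  unfolding quasi_local_def by (meson le_less_trans)

lemma quasi_local_add:
  fixes S T :: "'a::metric_space ell2 \<Rightarrow> 'a ell2"
  assumes "quasi_local e s S" "quasi_local e' s T"
  shows "quasi_local (e + e') s (\<lambda>f. S f + T f)"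
  unfolding quasi_local_def
proof (intro allI impI)
  fix C D :: "'a set" and f assume "\<forall>x\<in>C. \<forall>y\<in>D. s < dist x y"
  then have "norm (proj C (S (proj D f))) \<le> e * norm f" "norm (proj C (T (proj D f))) \<le> e' * norm f"
    using assms unfolding quasi_local_def by blast+
  then show "norm (proj C (S (proj D f) + T (proj D f))) \<le> (e + e') * norm f"
    using norm_triangle_ineq[of "proj C (S (proj D f))" "proj C (T (proj D f))"]
    by (simp add: proj_add algebra_simps)
qed

lemma quasi_local_diff:
  fixes S T :: "'a::metric_space ell2 \<Rightarrow> 'a ell2"
  assumes "quasi_local e s S" "quasi_local e' s T"
  shows "quasi_local (e + e') s (\<lambda>f. S f - T f)"
  unfolding quasi_local_def
proof (intro allI impI)
  fix C D :: "'a set" and f assume "\<forall>x\<in>C. \<forall>y\<in>D. s < dist x y"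
  then have "norm (proj C (S (proj D f))) \<le> e * norm f" "norm (proj C (T (proj D f))) \<le> e' * norm f"
    using assms unfolding quasi_local_def by blast+
  then show "norm (proj C (S (proj D f) - T (proj D f))) \<le> (e + e') * norm f"
    using norm_triangle_ineq4[of "proj C (S (proj D f))" "proj C (T (proj D f))"]
    by (simp add: proj_diff algebra_simps)
qed

text \<open>A nearby operator \<open>b\<close> of finite propagation has no block between sets
  further apart than its propagation, so only the norm of \<open>a - b\<close> counts.\<close>

lemma Roe_quasi_local:
  fixes a :: "'a::metric_space op"
  assumes "a \<in> uniform_Roe_algebra" "e > 0"
  obtains s where "quasi_local e s (blinfun_apply a)"
proof -
  obtain b where b: "b \<in> bounded_ops" "propagation b < \<infinity>" "dist b a < e"
    using assms unfolding uniform_Roe_algebra_def closure_approachable by blast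
  obtain R where R: "\<And>x z. ell2_fun (blinfun_apply b (delta x)) z \<noteq> 0 \<Longrightarrow> dist x z \<le> R"
    using b(2) propagation_finite_iff by blast
  have "quasi_local 0 R (blinfun_apply b)"
    unfolding quasi_local_def
  proof (intro allI impI)
    fix C D :: "'a set" and f assume far: "\<forall>x\<in>C. \<forall>y\<in>D. R < dist x y"
    have "ell2_fun (blinfun_apply b (proj D f)) z = 0" if "z \<in> C" for z
    proof (rule functional_eq_0[where K = "norm b"])
      show "cmod (ell2_fun (blinfun_apply b h) z) \<le> norm b * norm h" for h
        using cmod_ell2_fun_le norm_blinfun by (rule order.trans)
      show "ell2_fun (blinfun_apply b (delta x)) z = 0" if "x \<in> D" for x
        using R[of x z] far that \<open>z \<in> C\<close> by (metis dist_commute not_less)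
    qed (use b(1) in \<open>simp_all add: blinfun.add_right bounded_ops_def\<close>)
    then have "proj C (blinfun_apply b (proj D f)) = 0"
      by (auto intro!: ell2_eqI)
    then show "norm (proj C (blinfun_apply b (proj D f))) \<le> 0 * norm f" by simp
  qed
  moreover have "quasi_local e R (blinfun_apply (a - b))"
    unfolding quasi_local_def
  proof (intro allI impI)
    fix C D :: "'a set" and f
    have "norm (proj C (blinfun_apply (a - b) (proj D f))) \<le> norm (a - b) * norm (proj D f)"
      using norm_proj_le norm_blinfun by (rule order.trans)
    also have "\<dots> \<le> e * norm f"
      using b(3) norm_proj_le[of D f] \<open>e > 0\<close> by (intro mult_mono) (auto simp: dist_norm norm_minus_commute)
    finally show "norm (proj C (blinfun_apply (a - b) (proj D f))) \<le> e * norm f" .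
  qed
  ultimately have "quasi_local (0 + e) R (\<lambda>f. blinfun_apply b f + blinfun_apply (a - b) f)"
    by (rule quasi_local_add)
  then have "quasi_local e R (blinfun_apply a)" by (simp add: blinfun.diff_left)
  with that show ?thesis .
qed

section \<open>Consequences of uniform local finiteness\<close>

lemma cball_bound:
  assumes "uniformly_locally_finite (UNIV :: 'a::metric_space set)"
  obtains k :: nat where "\<And>x::'a. finite (cball x r)" "\<And>x::'a. card (cball x r) \<le> k"
proof -
  \<comment> \<open>The definition speaks only of positive radii; \<open>max r 1\<close> covers
    every real \<open>r\<close>.\<close>
  obtain k where k: "\<And>x::'a. finite (cball x (max r 1)) \<and> card (cball x (max r 1)) \<le> k"
    using assms unfolding uniformly_locally_finite_def
    by (metis Int_UNIV_left UNIV_I max.strict_coboundedI2 zero_less_one)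
  have sub: "cball x r \<subseteq> cball x (max r 1)" for x :: 'a by auto
  show ?thesis
    by (rule that[of k]) (use k sub in \<open>meson finite_subset, meson card_mono order.trans\<close>)
qed

text \<open>The 0-1 matrix of the relation \<open>dist x z \<le> r\<close> has at most
  \<open>k\<close> ones in each row and column, so its norm is at most \<open>k\<close>, as in
  Schur's test.\<close>

lemma Roe_element_connecting_neighbours:
  assumes ulf: "uniformly_locally_finite (UNIV :: 'a::metric_space set)"
  obtains a :: "'a::metric_space op" where "a \<in> uniform_Roe_algebra"
    "\<And>x z. dist x z \<le> r \<Longrightarrow> ell2_fun (blinfun_apply a (delta x)) z = 1"
proof -
  obtain k where k: "\<And>x::'a. finite (cball x r)" "\<And>x::'a. card (cball x r) \<le> k"
    using cball_bound[OF ulf, of r] by blast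
  define H where "H f z = (\<Sum>x\<in>cball z r. ell2_fun f x)" for f :: "'a ell2" and z
  have bound: "(\<Sum>z\<in>F. (cmod (H f z))\<^sup>2) \<le> (real k * norm f)\<^sup>2" if F: "finite F" for f F
  proof -
    define G where "G = (\<Union>z\<in>F. cball z r)"
    have G: "finite G" using F k by (auto simp: G_def)
    have "(\<Sum>z\<in>F. (cmod (H f z))\<^sup>2) \<le> (\<Sum>z\<in>F. real k * (\<Sum>x\<in>cball z r. (cmod (ell2_fun f x))\<^sup>2))"
    proof (rule sum_mono)
      fix z
      have "(cmod (H f z))\<^sup>2 \<le> (\<Sum>x\<in>cball z r. cmod (ell2_fun f x))\<^sup>2"
        unfolding H_def by (intro power_mono norm_sum) auto
      also have "\<dots> \<le> (\<Sum>x\<in>cball z r. (cmod (ell2_fun f x))\<^sup>2) * real (card (cball z r))"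
        using sum_squared_le_sum_of_squares[of "\<lambda>x. cmod (ell2_fun f x)" "cball z r"] k by simp
      also have "\<dots> \<le> (\<Sum>x\<in>cball z r. (cmod (ell2_fun f x))\<^sup>2) * real k"
        using k(2) by (intro mult_left_mono) (auto intro: sum_nonneg)
      finally show "(cmod (H f z))\<^sup>2 \<le> real k * (\<Sum>x\<in>cball z r. (cmod (ell2_fun f x))\<^sup>2)"
        by (simp add: mult.commute)
    qed
    also have "\<dots> = real k * (\<Sum>z\<in>F. \<Sum>x\<in>{x\<in>G. dist z x \<le> r}. (cmod (ell2_fun f x))\<^sup>2)"
      unfolding sum_distrib_left[symmetric]
      by (intro arg_cong2[where f = "(*)"] sum.cong) (auto simp: G_def)
    \<comment> \<open>After exchanging the sums each \<open>x\<close> is counted at most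
      \<open>k\<close> times; this is the second factor \<open>k\<close>, the first coming from
      Cauchy-Schwarz.\<close>
    also have "\<dots> = real k * (\<Sum>x\<in>G. \<Sum>z\<in>{z\<in>F. dist z x \<le> r}. (cmod (ell2_fun f x))\<^sup>2)"
      by (subst sum.swap_restrict[OF F G]) simp
    also have "\<dots> \<le> real k * (\<Sum>x\<in>G. real k * (cmod (ell2_fun f x))\<^sup>2)"
    proof (intro mult_left_mono sum_mono)
      fix x
      have "card {z\<in>F. dist z x \<le> r} \<le> card (cball x r)"
        by (rule card_mono[OF k(1)]) (auto simp: dist_commute)
      then have "card {z\<in>F. dist z x \<le> r} \<le> k" using k(2) order.trans by blast
      then show "(\<Sum>z\<in>{z\<in>F. dist z x \<le> r}. (cmod (ell2_fun f x))\<^sup>2) \<le> real k * (cmod (ell2_fun f x))\<^sup>2"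
        by (simp add: mult_right_mono)
    qed simp
    also have "\<dots> = (real k)\<^sup>2 * (norm (proj G f))\<^sup>2"
      by (simp add: norm_proj_finite[OF G] sum_distrib_left[symmetric] power2_eq_square[of "real k"])
    also have "\<dots> \<le> (real k)\<^sup>2 * (norm f)\<^sup>2"
      by (intro mult_left_mono power_mono norm_proj_le) auto
    finally show ?thesis by (simp add: power_mult_distrib)
  qed
  obtain a where a: "a \<in> bounded_ops" "\<And>f. ell2_fun (blinfun_apply a f) = H f"
    by (rule bounded_op_of_fun[of H "real k"])
      (use bound in \<open>auto simp: H_def sum.distrib sum_distrib_left\<close>)
  have entry: "ell2_fun (blinfun_apply a (delta x)) z = (if dist x z \<le> r then 1 else 0)" for x z
    using k(1)[of z] by (simp add: a H_def dist_commute)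
  show ?thesis
  proof
    show "a \<in> uniform_Roe_algebra"
      by (rule finite_propagation_in_Roe[OF a(1), of r]) (auto simp: entry split: if_splits)
  qed (simp add: entry)
qed

section \<open>Baire category, choice of signs and linear systems\<close>

text \<open>Baire's theorem for the Cantor space of subsets of an arbitrary set: the premises say that countably
  many closed sets cover the space.\<close>

lemma cylinder_Baire:
  fixes P :: "nat \<Rightarrow> 'a set \<Rightarrow> bool"
  assumes cover: "\<And>A. \<exists>n. P n A"
    and closed: "\<And>n A. \<not> P n A \<Longrightarrow> \<exists>G. finite G \<and> (\<forall>A'. A' \<inter> G = A \<inter> G \<longrightarrow> \<not> P n A')"
  obtains n G A\<^sub>0 where "finite G" "\<And>A. A \<inter> G = A\<^sub>0 \<inter> G \<Longrightarrow> P n A"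
proof (rule ccontr)
  assume contra: "\<not> thesis"
  note conclude = that
  \<comment> \<open>The negated conclusion: every cylinder, consisting of the sets with a given
    trace on a finite \<open>G\<close>, contains a set that violates \<open>P n\<close>.\<close>
  have dense: "\<exists>A'. A' \<inter> G = A \<inter> G \<and> \<not> P n A'" if "finite G" for n G A
  proof (rule ccontr)
    assume none: "\<not> ?thesis"
    have thesis
    proof (rule conclude)
      show "finite G" by fact
      show "P n A'" if "A' \<inter> G = A \<inter> G" for A'
        using none that by metis
    qed
    with contra show False ..
  qed
  \<comment> \<open>A pair \<open>p\<close> codes the cylinder of all sets with the same trace on
    \<open>fst p\<close> as \<open>snd p\<close>; this cylinder is to miss
    \<open>P n\<close>.\<close>
  define avoids where "avoids n p \<longleftrightarrow> (\<forall>A. A \<inter> fst p = snd p \<inter> fst p \<longrightarrow> \<not> P n A)" for n p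
  have step: "\<exists>q. finite (fst q) \<and> fst p \<subseteq> fst q \<and> snd q \<inter> fst p = snd p \<inter> fst p \<and> avoids n q"
    if fin: "finite (fst p)" for n p
  proof -
    obtain A' where A': "A' \<inter> fst p = snd p \<inter> fst p" "\<not> P n A'"
      using dense[OF fin] by metis
    obtain G where G: "finite G" "\<And>A. A \<inter> G = A' \<inter> G \<Longrightarrow> \<not> P n A"
      using closed[OF A'(2)] by metis
    have "avoids n (fst p \<union> G, A')"
      unfolding avoids_def fst_conv snd_conv
    proof (intro allI impI)
      fix A assume "A \<inter> (fst p \<union> G) = A' \<inter> (fst p \<union> G)"
      then have "A \<inter> G = A' \<inter> G" by blast
      then show "\<not> P n A" by (rule G(2))
    qed
    then show ?thesis
      using A'(1) G(1) fin by (intro exI[of _ "(fst p \<union> G, A')"]) simp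
  qed
  define Q where "Q n p q \<longleftrightarrow> fst p \<subseteq> fst q \<and> snd q \<inter> fst p = snd p \<inter> fst p \<and> avoids n q"
    for n and p q :: "'a set \<times> 'a set"
  have "\<exists>p. \<forall>n. finite (fst (p n)) \<and> Q n (p n) (p (Suc n))"
  proof (rule dependent_nat_choice)
    show "\<exists>p :: 'a set \<times> 'a set. finite (fst p)" by (rule exI[of _ "({}, {})"]) simp
    show "\<exists>q. finite (fst q) \<and> Q n p q" if "finite (fst p)" for p n
      using step[OF that, of n] by (simp add: Q_def)
  qed
  then obtain p where "\<forall>n. finite (fst (p n)) \<and> Q n (p n) (p (Suc n))" ..
  then have Q: "Q n (p n) (p (Suc n))" for n by simp
  have p: "fst (p n) \<subseteq> fst (p (Suc n))" "snd (p (Suc n)) \<inter> fst (p n) = snd (p n) \<inter> fst (p n)"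
    "avoids n (p (Suc n))" for n
    using Q[of n] by (simp_all add: Q_def)
  have mono: "fst (p m) \<subseteq> fst (p n) \<and> snd (p n) \<inter> fst (p m) = snd (p m) \<inter> fst (p m)" if "m \<le> n" for m n
    using that
  proof (induction n rule: dec_induct)
    case (step n)
    then show ?case using p(1)[of n] p(2)[of n] by blast
  qed simp
  \<comment> \<open>The prescribed traces extend one another, so they glue to one set that lies in
    all the nested cylinders and satisfies no \<open>P n\<close>.\<close>
  define A where "A = (\<Union>n. snd (p n) \<inter> fst (p n))"
  have "A \<inter> fst (p n) = snd (p n) \<inter> fst (p n)" for n
  proof
    show "A \<inter> fst (p n) \<subseteq> snd (p n) \<inter> fst (p n)"
    proof
      fix x assume "x \<in> A \<inter> fst (p n)"
      then obtain k where k: "x \<in> snd (p k)" "x \<in> fst (p k)" "x \<in> fst (p n)" by (auto simp: A_def)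
      show "x \<in> snd (p n) \<inter> fst (p n)"
        using mono[of k n] mono[of n k] nat_le_linear[of k n] k by blast
    qed
  qed (auto simp: A_def)
  then have "\<not> P n A" for n
    using p(3)[of n] by (simp add: avoids_def)
  with cover show False by blast
qed

text \<open>Signs are chosen one vector at a time: by the parallelogram law, either adding or
  subtracting \<open>w i\<close> increases the squared norm by at least
  \<open>(norm (w i))\<^sup>2\<close>. The offset \<open>a\<close> in the induction carries the
  signed sum already built.\<close>

lemma exists_signs_norm_ge:
  fixes w :: "'i \<Rightarrow> 'v::real_inner"
  assumes "finite I"
  shows "\<exists>S\<subseteq>I. (\<Sum>i\<in>I. (norm (w i))\<^sup>2) \<le> (norm ((\<Sum>i\<in>S. w i) - (\<Sum>i\<in>I - S. w i)))\<^sup>2"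
proof -
  have "\<exists>S\<subseteq>I. (norm a)\<^sup>2 + (\<Sum>i\<in>I. (norm (w i))\<^sup>2) \<le>
      (norm (a + (\<Sum>i\<in>S. w i) - (\<Sum>i\<in>I - S. w i)))\<^sup>2" for a
    using assms
  proof (induction I arbitrary: a rule: finite_induct)
    case (insert i I)
    have "(norm (a + w i))\<^sup>2 + (norm (a - w i))\<^sup>2 = 2 * ((norm a)\<^sup>2 + (norm (w i))\<^sup>2)"
      by (simp add: power2_norm_eq_inner inner_add inner_diff inner_commute)
    then have "(norm a)\<^sup>2 + (norm (w i))\<^sup>2 \<le> (norm (a + w i))\<^sup>2 \<or>
        (norm a)\<^sup>2 + (norm (w i))\<^sup>2 \<le> (norm (a - w i))\<^sup>2"
      by (smt (verit))
    then show ?case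
    proof
      assume 1: "(norm a)\<^sup>2 + (norm (w i))\<^sup>2 \<le> (norm (a + w i))\<^sup>2"
      obtain S where S: "S \<subseteq> I" "(norm (a + w i))\<^sup>2 + (\<Sum>i\<in>I. (norm (w i))\<^sup>2) \<le>
          (norm (a + w i + (\<Sum>i\<in>S. w i) - (\<Sum>i\<in>I - S. w i)))\<^sup>2"
        using insert.IH by blast
      have "i \<notin> S" "finite S" "insert i I - insert i S = I - S"
        using S(1) insert.hyps finite_subset by auto
      then show ?thesis
        using S 1 insert.hyps by (intro exI[of _ "insert i S"]) (auto simp: algebra_simps)
    next
      assume 2: "(norm a)\<^sup>2 + (norm (w i))\<^sup>2 \<le> (norm (a - w i))\<^sup>2"
      obtain S where S: "S \<subseteq> I" "(norm (a - w i))\<^sup>2 + (\<Sum>i\<in>I. (norm (w i))\<^sup>2) \<le>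
          (norm (a - w i + (\<Sum>i\<in>S. w i) - (\<Sum>i\<in>I - S. w i)))\<^sup>2"
        using insert.IH by blast
      have "i \<notin> S" using S(1) insert.hyps by auto
      then have "insert i I - S = insert i (I - S)" by auto
      then show ?thesis
        using S 2 insert.hyps by (intro exI[of _ S]) (auto simp: algebra_simps)
    qed
  qed simp
  from this[of 0] show ?thesis by simp
qed

text \<open>The sign choice applied to the images of the coordinates of \<open>v\<close> in
  \<open>E\<close>; \<open>S\<close> gathers those that keep their sign. The left side is the
  average of the squared norm over all choices of signs.\<close>

lemma exists_signs_proj:
  fixes T :: "'a ell2 \<Rightarrow> 'b ell2"
  assumes "finite E" and add: "\<And>f g. T (f + g) = T f + T g"
    and scale: "\<And>c f. T (scaleC c f) = scaleC c (T f)"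
  shows "\<exists>S\<subseteq>E. (\<Sum>x\<in>E. (cmod (ell2_fun v x))\<^sup>2 * (norm (T (delta x)))\<^sup>2) \<le>
    (norm (T (proj S v) - T (proj (E - S) v)))\<^sup>2"
proof -
  have T0: "T 0 = 0" using add[of 0 0] by simp
  have T_proj: "T (proj S v) = (\<Sum>x\<in>S. scaleC (ell2_fun v x) (T (delta x)))" if "S \<subseteq> E" for S
  proof -
    have S: "finite S" using that \<open>finite E\<close> finite_subset by blast
    then show ?thesis
      unfolding proj_finite[OF S] by (induction S rule: finite_induct) (auto simp: T0 add scale)
  qed
  show ?thesis
    using exists_signs_norm_ge[OF \<open>finite E\<close>, of "\<lambda>x. scaleC (ell2_fun v x) (T (delta x))"]
    by (auto simp: T_proj norm_scaleC power_mult_distrib)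
qed

text \<open>Gaussian elimination by induction on the equations: one without nonzero coefficient is
  dropped, any other eliminates an unknown.\<close>

lemma underdetermined_system:
  fixes m :: "'y \<Rightarrow> 'x \<Rightarrow> 'k::field"
  assumes "finite B" "finite A" "card B < card A"
  shows "\<exists>c. (\<exists>x\<in>A. c x \<noteq> 0) \<and> (\<forall>y\<in>B. (\<Sum>x\<in>A. c x * m y x) = 0)"
  using assms
proof (induction B arbitrary: A m rule: finite_induct)
  case empty
  then obtain x where "x \<in> A" by (metis card.empty equals0I less_irrefl)
  then show ?case by (intro exI[of _ "\<lambda>_. 1"]) auto
next
  case (insert y B)
  show ?case
  proof (cases "\<forall>x\<in>A. m y x = 0")
    case True
    then show ?thesis using insert.IH[of A m] insert.prems insert.hyps by auto
  next
    case False
    then obtain x\<^sub>0 where x\<^sub>0: "x\<^sub>0 \<in> A" "m y x\<^sub>0 \<noteq> 0" by blast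
    define A' where "A' = A - {x\<^sub>0}"
    have A': "finite A'" "x\<^sub>0 \<notin> A'" "A = insert x\<^sub>0 A'" "card B < card A'"
      using insert x\<^sub>0 by (auto simp: A'_def)
    obtain c where c: "\<exists>x\<in>A'. c x \<noteq> 0"
      "\<And>z. z \<in> B \<Longrightarrow> (\<Sum>x\<in>A'. c x * (m z x - m z x\<^sub>0 * (m y x / m y x\<^sub>0))) = 0"
      using insert.IH[of A' "\<lambda>z x. m z x - m z x\<^sub>0 * (m y x / m y x\<^sub>0)"] A' by blast
    \<comment> \<open>\<open>k\<close> solves equation \<open>y\<close> for the pivot unknown
      \<open>x\<^sub>0\<close>; the reduced coefficients account for it in the other
      equations.\<close>
    define k where "k = - (\<Sum>x\<in>A'. c x * m y x) / m y x\<^sub>0"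
    define c' where "c' = c(x\<^sub>0 := k)"
    have sum_c': "(\<Sum>x\<in>A. c' x * m z x) = k * m z x\<^sub>0 + (\<Sum>x\<in>A'. c x * m z x)" for z
    proof -
      have "(\<Sum>x\<in>A'. c' x * m z x) = (\<Sum>x\<in>A'. c x * m z x)"
        using A'(2) by (intro sum.cong) (auto simp: c'_def)
      then show ?thesis using A' by (simp add: c'_def)
    qed
    show ?thesis
    proof (intro exI conjI ballI)
      show "\<exists>x\<in>A. c' x \<noteq> 0" using c(1) A' by (auto simp: c'_def)
      fix z assume "z \<in> insert y B"
      then consider "z = y" | "z \<in> B" by blast
      then show "(\<Sum>x\<in>A. c' x * m z x) = 0"
      proof cases
        case 1
        then show ?thesis unfolding sum_c' k_def using x\<^sub>0 by simp
      next
        case 2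
        have "(\<Sum>x\<in>A'. c x * (m z x - m z x\<^sub>0 * (m y x / m y x\<^sub>0))) =
            (\<Sum>x\<in>A'. c x * m z x) - (m z x\<^sub>0 / m y x\<^sub>0) * (\<Sum>x\<in>A'. c x * m y x)"
          unfolding sum_distrib_left sum_subtractf[symmetric]
          by (rule sum.cong) (auto simp: algebra_simps)
        with c(2)[OF 2] show ?thesis unfolding sum_c' k_def by (simp add: algebra_simps)
      qed
    qed
  qed
qed

section \<open>Unitaries between uniform Roe algebras\<close>

text \<open>What the argument uses of an isomorphism, in a form closed under exchanging
  \<open>U\<close> and \<open>V\<close>, so that each result has a mirror image. Quasi-locality of
  \<open>T\<close>, the conjugate of a matrix with entry 1 at all pairs at distance at most
  \<open>r\<close>, will make the induced maps coarse.\<close>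

locale roe_unitary =
  fixes U :: "'a::metric_space ell2 \<Rightarrow> 'b::metric_space ell2" and V :: "'b ell2 \<Rightarrow> 'a ell2"
  assumes ulf: "uniformly_locally_finite (UNIV :: 'a set)" "uniformly_locally_finite (UNIV :: 'b set)"
    and U_add: "U (f + f') = U f + U f'" and V_add: "V (g + g') = V g + V g'"
    and U_scaleC: "U (scaleC c f) = scaleC c (U f)" and V_scaleC: "V (scaleC c g) = scaleC c (V g)"
    and VU [simp]: "V (U f) = f" and UV [simp]: "U (V g) = g"
    and adjoint: "cinner (U f) g = cinner f (V g)"
    and quasi_local_proj: "0 < e \<Longrightarrow> \<exists>s. quasi_local e s (\<lambda>g. U (proj A (V g)))"
    and quasi_local_proj': "0 < e \<Longrightarrow> \<exists>s. quasi_local e s (\<lambda>f. V (proj B (U f)))"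
    and connecting: "\<exists>(W :: 'a op) (T :: 'b op). (\<forall>f. blinfun_apply T (U f) = U (blinfun_apply W f)) \<and>
      (\<forall>x z. dist x z \<le> r \<longrightarrow> ell2_fun (blinfun_apply W (delta x)) z = 1) \<and>
      (\<forall>e>0. \<exists>s. quasi_local e s (blinfun_apply T))"
    and connecting': "\<exists>(W :: 'b op) (T :: 'a op). (\<forall>g. blinfun_apply T (V g) = V (blinfun_apply W g)) \<and>
      (\<forall>y z. dist y z \<le> r \<longrightarrow> ell2_fun (blinfun_apply W (delta y)) z = 1) \<and>
      (\<forall>e>0. \<exists>s. quasi_local e s (blinfun_apply T))"
begin

lemma swap: "roe_unitary V U"
proof unfold_locales
  show "cinner (V g) f = cinner g (U f)" for f g
    by (metis adjoint cinner_commute)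
qed (use ulf U_add V_add U_scaleC V_scaleC quasi_local_proj quasi_local_proj' connecting connecting'
    in \<open>simp_all\<close>)

lemma norm_U [simp]: "norm (U f) = norm f"
proof -
  have "complex_of_real ((norm (U f))\<^sup>2) = complex_of_real ((norm f)\<^sup>2)"
    unfolding cinner_self[symmetric] by (simp add: adjoint)
  then have "(norm (U f))\<^sup>2 = (norm f)\<^sup>2" by (simp only: of_real_eq_iff)
  then show ?thesis by simp
qed

lemma U_diff: "U (f - f') = U f - U f'"
  using U_add[of "f - f'" f'] by simp

lemma entry: "cmod (ell2_fun (V (delta y)) x) = cmod (ell2_fun (U (delta x)) y)"
  using adjoint[of "delta x" "delta y"] by simp

section \<open>Quasi-locality uniformly over all subsets\<close>

lemma not_quasi_local_open:
  assumes "\<not> quasi_local e s (\<lambda>g. U (proj A (V g)))"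
  obtains G where "finite G"
    "\<And>A'. A' \<inter> G = A \<inter> G \<Longrightarrow> \<not> quasi_local e s (\<lambda>g. U (proj A' (V g)))"
proof -
  from assms have "\<exists>C D f. (\<forall>x\<in>C. \<forall>y\<in>D. s < dist x y) \<and>
      e * norm f < norm (proj C (U (proj A (V (proj D f)))))"
    by (simp add: quasi_local_def not_le)
  then obtain C D f where far: "\<forall>x\<in>C. \<forall>y\<in>D. s < dist x y"
    and big: "e * norm f < norm (proj C (U (proj A (V (proj D f)))))"
    by (elim exE conjE)
  define h where "h = V (proj D f)"
  \<comment> \<open>The failure is witnessed by the single vector \<open>h\<close>. Both
    \<open>A\<close> and \<open>A'\<close> can lose a tail of norm below \<open>k\<close>, so
    \<open>k\<close> is half of the gap.\<close>
  define k where "k = (norm (proj C (U (proj A h))) - e * norm f) / 2"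
  have "k > 0" using big by (simp add: k_def h_def)
  then obtain G where G: "finite G" "norm (proj (- G) h) < k" by (rule norm_proj_tail)
  have "e * norm f < norm (proj C (U (proj A' h)))" if eq: "A' \<inter> G = A \<inter> G" for A'
  proof -
    have "x \<in> A' \<longleftrightarrow> x \<in> A" if "x \<in> G" for x using eq that by blast
    then have "proj A h - proj A' h = proj A (proj (- G) h) - proj A' (proj (- G) h)"
      by (auto intro!: ell2_eqI)
    then have "norm (proj A h - proj A' h) \<le> norm (proj A (proj (- G) h)) + norm (proj A' (proj (- G) h))"
      using norm_triangle_ineq4 by metis
    also have "\<dots> < k + k"
      by (intro add_strict_mono le_less_trans[OF norm_proj_le G(2)])
    finally have *: "norm (proj A h - proj A' h) < 2 * k" by simp
    have "norm (proj C (U (proj A h))) - norm (proj C (U (proj A' h))) \<le>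
        norm (proj C (U (proj A h)) - proj C (U (proj A' h)))"
      by (rule norm_triangle_ineq2)
    also have "\<dots> = norm (proj C (U (proj A h - proj A' h)))"
      by (simp add: U_diff proj_diff)
    also have "\<dots> \<le> norm (proj A h - proj A' h)"
      by (metis norm_proj_le norm_U)
    finally show ?thesis using * by (simp add: k_def)
  qed
  then have "\<not> quasi_local e s (\<lambda>g. U (proj A' (V g)))" if "A' \<inter> G = A \<inter> G" for A'
    using quasi_localD[of e s "\<lambda>g. U (proj A' (V g))" C D f] far[rule_format] that
    by (metis h_def not_le)
  with G(1) show ?thesis by (rule that)
qed

text \<open>Baire gives one scale for all sets in a cylinder over some finite \<open>G\<close>. Any
  \<open>A\<close> is reached from that cylinder by a correction inside \<open>G\<close>, and only
  finitely many corrections occur.\<close>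

lemma uniformly_quasi_local:
  assumes "e > 0"
  obtains s where "\<And>A. quasi_local e s (\<lambda>g. U (proj A (V g)))"
proof -
  define Q where "Q n A \<longleftrightarrow> quasi_local (e / 3) (real n) (\<lambda>g. U (proj A (V g)))" for n A
  have cover: "\<exists>n. Q n A" for A
  proof -
    obtain s where "quasi_local (e / 3) s (\<lambda>g. U (proj A (V g)))"
      using quasi_local_proj[of "e / 3" A] assms by auto
    then have "Q (nat \<lceil>s\<rceil>) A"
      unfolding Q_def by (rule quasi_local_mono) linarith
    then show ?thesis ..
  qed
  then obtain k where k: "\<And>A. Q (k A) A" by metis
  have closed: "\<exists>G. finite G \<and> (\<forall>A'. A' \<inter> G = A \<inter> G \<longrightarrow> \<not> Q n A')" if "\<not> Q n A" for n A
  proof -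
    have "\<not> quasi_local (e / 3) (real n) (\<lambda>g. U (proj A (V g)))"
      using that by (simp add: Q_def)
    then obtain G where "finite G"
      "\<And>A'. A' \<inter> G = A \<inter> G \<Longrightarrow> \<not> quasi_local (e / 3) (real n) (\<lambda>g. U (proj A' (V g)))"
      by (rule not_quasi_local_open) (rule that)
    then show ?thesis by (intro exI[of _ G]) (simp add: Q_def)
  qed
  obtain n G A\<^sub>0 where G: "finite G" "\<And>A. A \<inter> G = A\<^sub>0 \<inter> G \<Longrightarrow> Q n A"
    by (rule cylinder_Baire[of Q]) (rule cover, erule closed, rule that)
  define s where "s = real (Max (insert n (k ` Pow G)))"
  have s: "real n \<le> s" "\<And>H. H \<subseteq> G \<Longrightarrow> real (k H) \<le> s"
    using G(1) by (auto simp: s_def)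
  have "quasi_local e s (\<lambda>g. U (proj A (V g)))" for A
  proof -
    \<comment> \<open>In terms of projections \<open>A\<close> is \<open>A \<inter> G\<close> plus
      \<open>A\<^sub>1\<close> minus \<open>A\<^sub>0 \<inter> G\<close>, where the last two sets
      lie in the cylinder; each term has error \<open>e / 3\<close>.\<close>
    define A\<^sub>1 where "A\<^sub>1 = (A - G) \<union> (A\<^sub>0 \<inter> G)"
    have "quasi_local (e / 3) s (\<lambda>g. U (proj (A \<inter> G) (V g)))"
      using k[of "A \<inter> G"] s(2)[of "A \<inter> G"] unfolding Q_def by (auto intro: quasi_local_mono)
    moreover have "quasi_local (e / 3) s (\<lambda>g. U (proj A\<^sub>1 (V g)))"
      using G(2)[of A\<^sub>1] s(1) unfolding Q_def by (auto simp: A\<^sub>1_def intro: quasi_local_mono)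
    moreover have "quasi_local (e / 3) s (\<lambda>g. U (proj (A\<^sub>0 \<inter> G) (V g)))"
      using G(2)[of "A\<^sub>0 \<inter> G"] s(1) unfolding Q_def by (auto intro: quasi_local_mono)
    ultimately have "quasi_local (e / 3 + e / 3 + e / 3) s
        (\<lambda>g. U (proj (A \<inter> G) (V g)) + U (proj A\<^sub>1 (V g)) - U (proj (A\<^sub>0 \<inter> G) (V g)))"
      by (intro quasi_local_add quasi_local_diff)
    also have "(\<lambda>g. U (proj (A \<inter> G) (V g)) + U (proj A\<^sub>1 (V g)) - U (proj (A\<^sub>0 \<inter> G) (V g))) =
        (\<lambda>g. U (proj A (V g)))"
      unfolding U_add[symmetric] U_diff[symmetric]
      by (rule ext, rule arg_cong[where f = U], rule ell2_eqI) (auto simp: A\<^sub>1_def)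
    finally show ?thesis by simp
  qed
  with that show ?thesis by blast
qed

section \<open>Sign changes and the localisation of the unitary\<close>

lemma quasi_local_signs:
  assumes "\<And>A. quasi_local e s (\<lambda>g. U (proj A (V g)))"
  shows "quasi_local (2 * e) s (\<lambda>g. U (proj S (V g) - proj S' (V g)))"
  using quasi_local_diff[OF assms assms, of S S'] by (simp add: U_diff)

text \<open>By quasi-locality of sign changes, most of the mass of the vectors
  \<open>V (delta y)\<close>, weighted by the squared entries of \<open>v\<close>, lies in the ball
  \<open>P\<close> around \<open>x\<close>. If all entries of \<open>v\<close> were small, a ball of
  at most \<open>k\<close> points could not hold that much.\<close>

lemma U_delta_not_spread:
  obtains d where "d > 0" "\<And>x. \<exists>y. d \<le> cmod (ell2_fun (U (delta x)) y)"
proof -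
  interpret sw: roe_unitary V U by (rule swap)
  obtain s where s: "\<And>B. quasi_local (1 / 4) s (\<lambda>f. V (proj B (U f)))"
    using sw.uniformly_quasi_local[of "1 / 4"] by auto
  obtain k where k: "\<And>x::'a. finite (cball x s)" "\<And>x::'a. card (cball x s) \<le> k"
    using cball_bound[OF ulf(1), of s] by blast
  \<comment> \<open>Chosen so that \<open>d\<^sup>2 * real k\<close> stays below 1/2.\<close>
  define d where "d = 1 / (real k + 1)"
  have "d > 0" by (simp add: d_def)
  have "\<exists>y. d \<le> cmod (ell2_fun (U (delta x)) y)" for x
  proof (rule ccontr)
    assume "\<not> ?thesis"
    then have small: "cmod (ell2_fun (U (delta x)) y) \<le> d" for y
      by (meson linear)
    define v where "v = U (delta x)"
    define P where "P = cball x s"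
    have P: "finite P" "card P \<le> k" using k by (auto simp: P_def)
    obtain E where E: "finite E" "norm (proj (- E) v) < 1 / 2"
      using norm_proj_tail[of "1 / 2" v] by auto
    have "(norm (proj (- E) v))\<^sup>2 \<le> (1 / 2)\<^sup>2"
      using E(2) by (intro power_mono) auto
    then have "3 / 4 \<le> (norm (proj E v))\<^sup>2"
      using norm_proj_Pythagoras[of v E] by (simp add: v_def power2_eq_square)
    then have mass: "3 / 4 \<le> (\<Sum>y\<in>E. (cmod (ell2_fun v y))\<^sup>2)"
      by (simp add: norm_proj_finite[OF E(1)])
    obtain S where S: "S \<subseteq> E"
      "(\<Sum>y\<in>E. (cmod (ell2_fun v y))\<^sup>2 * (norm (proj (- P) (V (delta y))))\<^sup>2) \<le>
        (norm (proj (- P) (V (proj S v)) - proj (- P) (V (proj (E - S) v))))\<^sup>2"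
      using exists_signs_proj[OF E(1), of "\<lambda>f. proj (- P) (V f)" v]
      by (auto simp: V_add V_scaleC proj_add proj_scaleC)
    \<comment> \<open>\<open>delta x\<close> is supported at \<open>x\<close>, so \<open>V\<close>
      pulls the signed truncation of \<open>v\<close> back to a vector whose part outside
      \<open>P\<close> has norm at most 1/2.\<close>
    have "norm (proj (- P) (V (proj S (U (proj {x} (delta x))) - proj (E - S) (U (proj {x} (delta x)))))) \<le>
        2 * (1 / 4) * norm (delta x)"
      by (rule quasi_localD[OF sw.quasi_local_signs[OF s]]) (auto simp: P_def dist_commute)
    then have "norm (proj (- P) (V (proj S v)) - proj (- P) (V (proj (E - S) v))) \<le> 1 / 2"
      by (simp add: proj_singleton v_def sw.U_diff proj_diff)
    then have "(norm (proj (- P) (V (proj S v)) - proj (- P) (V (proj (E - S) v))))\<^sup>2 \<le> (1 / 2)\<^sup>2"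
      by (intro power_mono) auto
    with S have out: "(\<Sum>y\<in>E. (cmod (ell2_fun v y))\<^sup>2 * (norm (proj (- P) (V (delta y))))\<^sup>2) \<le> 1 / 4"
      by (simp add: power2_eq_square)
    have "(\<Sum>y\<in>E. (cmod (ell2_fun v y))\<^sup>2) =
        (\<Sum>y\<in>E. (cmod (ell2_fun v y))\<^sup>2 * (norm (proj P (V (delta y))))\<^sup>2) +
        (\<Sum>y\<in>E. (cmod (ell2_fun v y))\<^sup>2 * (norm (proj (- P) (V (delta y))))\<^sup>2)"
      unfolding sum.distrib[symmetric] distrib_left[symmetric] norm_proj_Pythagoras[symmetric]
      by simp
    with mass out have "1 / 2 \<le> (\<Sum>y\<in>E. (cmod (ell2_fun v y))\<^sup>2 * (norm (proj P (V (delta y))))\<^sup>2)"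
      by simp
    also have "\<dots> \<le> (\<Sum>y\<in>E. d\<^sup>2 * (norm (proj P (V (delta y))))\<^sup>2)"
      using small by (intro sum_mono mult_right_mono power_mono) (auto simp: v_def)
    also have "\<dots> = d\<^sup>2 * (\<Sum>y\<in>E. \<Sum>z\<in>P. (cmod (ell2_fun (U (delta z)) y))\<^sup>2)"
      by (simp add: norm_proj_finite[OF P(1)] sum_distrib_left entry)
    \<comment> \<open>Summed over \<open>y\<close> first, each unit vector
      \<open>U (delta z)\<close> contributes at most 1.\<close>
    also have "\<dots> = d\<^sup>2 * (\<Sum>z\<in>P. \<Sum>y\<in>E. (cmod (ell2_fun (U (delta z)) y))\<^sup>2)"
      by (subst sum.swap) simp
    also have "\<dots> \<le> d\<^sup>2 * (\<Sum>z\<in>P. 1)"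
    proof (intro mult_left_mono sum_mono)
      show "(\<Sum>y\<in>E. (cmod (ell2_fun (U (delta z)) y))\<^sup>2) \<le> 1" for z
        using norm_proj_le[of E "U (delta z)"]
        by (simp add: norm_proj_finite[OF E(1), symmetric] power_le_one)
    qed simp
    also have "\<dots> \<le> d\<^sup>2 * real k" using P(2) by (simp add: mult_left_mono)
    also have "d\<^sup>2 * real k = real k / (real k + 1)\<^sup>2" by (simp add: d_def power_divide)
    also have "\<dots> < 1 / 2"
    proof -
      have "2 * real k < (real k + 1)\<^sup>2" by (simp add: power2_sum add_nonneg_pos)
      then show ?thesis by (simp add: pos_divide_less_eq)
    qed
    finally show False by simp
  qed
  with that \<open>d > 0\<close> show ?thesis by blast
qed

text \<open>The conjugated projection onto \<open>x\<close> sends \<open>delta (f x)\<close> to a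
  multiple of \<open>U (delta x)\<close> by a scalar of modulus at least \<open>d\<close>; dividing
  by it turns the error \<open>e * d\<close> into \<open>e\<close>.\<close>

lemma U_delta_concentrated:
  assumes "d > 0" and f: "\<And>x. d \<le> cmod (ell2_fun (U (delta x)) (f x))" and "e > 0"
  obtains s where "\<And>x. norm (proj (- cball (f x) s) (U (delta x))) \<le> e"
proof -
  obtain s where s: "\<And>A. quasi_local (e * d) s (\<lambda>g. U (proj A (V g)))"
    using uniformly_quasi_local[of "e * d"] assms by auto
  have "norm (proj (- cball (f x) s) (U (delta x))) \<le> e" for x
  proof -
    let ?n = "norm (proj (- cball (f x) s) (U (delta x)))"
    have "norm (proj (- cball (f x) s) (U (proj {x} (V (proj {f x} (delta (f x))))))) \<le>
        e * d * norm (delta (f x))"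
      by (rule quasi_localD[OF s]) (auto simp: dist_commute)
    then have "cmod (ell2_fun (U (delta x)) (f x)) * ?n \<le> e * d"
      by (simp add: proj_singleton[of "f x"] proj_singleton[of x] U_scaleC proj_scaleC norm_scaleC entry)
    moreover have "d * ?n \<le> cmod (ell2_fun (U (delta x)) (f x)) * ?n"
      using f by (intro mult_right_mono) auto
    ultimately have "d * ?n \<le> d * e" by (simp add: mult.commute)
    then show ?thesis using \<open>d > 0\<close> by simp
  qed
  with that show ?thesis by blast
qed

text \<open>The product of \<open>T (U (delta x))\<close> with \<open>U (delta x')\<close> is an
  entry of \<open>W\<close>, namely 1. If \<open>f x\<close> and \<open>f x'\<close> were far apart,
  concentration near these points and quasi-locality of \<open>T\<close> would make it at most 3/4
  in modulus.\<close>

lemma localisation_coarse: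
  assumes "d > 0" and f: "\<And>x. d \<le> cmod (ell2_fun (U (delta x)) (f x))"
  obtains R where "\<And>x x'. dist x x' \<le> r \<Longrightarrow> dist (f x) (f x') \<le> R"
proof -
  obtain W :: "'a op" and T :: "'b op" where
    W: "\<And>h. blinfun_apply T (U h) = U (blinfun_apply W h)"
      "\<And>x z. dist x z \<le> r \<Longrightarrow> ell2_fun (blinfun_apply W (delta x)) z = 1"
    and T: "\<And>e. 0 < e \<Longrightarrow> \<exists>s. quasi_local e s (blinfun_apply T)"
    using connecting[of r] by blast
  define K where "K = norm T + 1"
  have K: "K > 0" "norm T \<le> K" by (auto simp: K_def add_nonneg_pos)
  obtain s where s: "\<And>x. norm (proj (- cball (f x) s) (U (delta x))) \<le> 1 / (4 * K)"
    using U_delta_concentrated[OF assms, of "1 / (4 * K)"] K by auto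
  obtain s' where s': "quasi_local (1 / 4) s' (blinfun_apply T)" using T[of "1 / 4"] by auto
  have "dist (f x) (f x') \<le> s' + 2 * s" if near: "dist x x' \<le> r" for x x'
  proof (rule ccontr)
    assume far: "\<not> dist (f x) (f x') \<le> s' + 2 * s"
    let ?B = "cball (f x) s" and ?B' = "cball (f x') s"
    let ?a = "U (delta x)" and ?b = "U (delta x')"
    have ql: "norm (proj ?B' (blinfun_apply T (proj ?B ?a))) \<le> 1 / 4 * norm ?a"
    proof (rule quasi_localD[OF s'])
      fix y z assume "y \<in> ?B'" "z \<in> ?B"
      then have "dist (f x') y \<le> s" "dist (f x) z \<le> s" by auto
      moreover have "dist (f x) (f x') \<le> dist (f x) z + dist y z + dist (f x') y"
        using dist_triangle[of "f x" "f x'" z] dist_triangle[of z "f x'" y]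
        by (simp add: dist_commute)
      ultimately show "s' < dist y z" using far by linarith
    qed
    have "cinner (blinfun_apply T ?a) ?b = 1"
      unfolding W(1) adjoint using W(2)[OF near] by simp
    moreover have "cinner (blinfun_apply T ?a) ?b =
        cinner (proj ?B' (blinfun_apply T (proj ?B ?a))) ?b +
        cinner (blinfun_apply T (proj ?B ?a)) (proj (- ?B') ?b) +
        cinner (blinfun_apply T (proj (- ?B) ?a)) ?b"
    proof -
      have "blinfun_apply T ?a = blinfun_apply T (proj ?B ?a) + blinfun_apply T (proj (- ?B) ?a)"
        by (simp add: blinfun.add_right[symmetric] proj_decomp)
      moreover have "cinner (blinfun_apply T (proj ?B ?a)) ?b =
          cinner (blinfun_apply T (proj ?B ?a)) (proj ?B' ?b) +
          cinner (blinfun_apply T (proj ?B ?a)) (proj (- ?B') ?b)"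
        by (simp add: cinner_add_right[symmetric] proj_decomp)
      ultimately show ?thesis by (simp add: cinner_add_left cinner_proj)
    qed
    moreover have "cmod (cinner (proj ?B' (blinfun_apply T (proj ?B ?a))) ?b) \<le> 1 / 4"
      using cmod_cinner_le[of "proj ?B' (blinfun_apply T (proj ?B ?a))" ?b] ql by simp
    moreover have "cmod (cinner (blinfun_apply T (proj ?B ?a)) (proj (- ?B') ?b)) \<le> 1 / 4"
    proof -
      have "norm (blinfun_apply T (proj ?B ?a)) \<le> norm T * norm (proj ?B ?a)" by (rule norm_blinfun)
      also have "\<dots> \<le> K * 1"
        using K norm_proj_le[of ?B ?a] by (intro mult_mono) auto
      finally have "norm (blinfun_apply T (proj ?B ?a)) * norm (proj (- ?B') ?b) \<le> K * (1 / (4 * K))"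
        using s[of x'] K by (intro mult_mono) auto
      then show ?thesis
        using K cmod_cinner_le[of "blinfun_apply T (proj ?B ?a)" "proj (- ?B') ?b"] by simp
    qed
    moreover have "cmod (cinner (blinfun_apply T (proj (- ?B) ?a)) ?b) \<le> 1 / 4"
    proof -
      have "norm (blinfun_apply T (proj (- ?B) ?a)) \<le> norm T * norm (proj (- ?B) ?a)" by (rule norm_blinfun)
      also have "\<dots> \<le> K * (1 / (4 * K))"
        using K s[of x] by (intro mult_mono) auto
      finally show ?thesis
        using K cmod_cinner_le[of "blinfun_apply T (proj (- ?B) ?a)" ?b] by simp
    qed
    ultimately show False
      using norm_triangle_ineq[of "cinner (proj ?B' (blinfun_apply T (proj ?B ?a))) ?b +
          cinner (blinfun_apply T (proj ?B ?a)) (proj (- ?B') ?b)"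
          "cinner (blinfun_apply T (proj (- ?B) ?a)) ?b"]
        norm_triangle_ineq[of "cinner (proj ?B' (blinfun_apply T (proj ?B ?a))) ?b"
          "cinner (blinfun_apply T (proj ?B ?a)) (proj (- ?B') ?b)"]
      by simp
  qed
  with that show ?thesis by blast
qed

text \<open>\<open>V (delta (f x))\<close> has an entry of modulus at least \<open>d\<close> at
  \<open>x\<close>, yet its part away from \<open>g (f x)\<close> has norm at most
  \<open>d / 2\<close>.\<close>

lemma localisation_inverse:
  assumes "d > 0" and f: "\<And>x. d \<le> cmod (ell2_fun (U (delta x)) (f x))"
    and "d' > 0" and g: "\<And>y. d' \<le> cmod (ell2_fun (V (delta y)) (g y))"
  obtains R where "\<And>x. dist (g (f x)) x \<le> R"
proof -
  interpret sw: roe_unitary V U by (rule swap)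
  obtain s where s: "\<And>y. norm (proj (- cball (g y) s) (V (delta y))) \<le> d / 2"
    using sw.U_delta_concentrated[OF \<open>d' > 0\<close> g, of "d / 2"] \<open>d > 0\<close> by auto
  have "dist (g (f x)) x \<le> s" for x
  proof (rule ccontr)
    assume "\<not> dist (g (f x)) x \<le> s"
    then have "x \<in> - cball (g (f x)) s" by simp
    from cmod_ell2_fun_le_proj[OF this] have "cmod (ell2_fun (V (delta (f x))) x) \<le> d / 2"
      using s[of "f x"] by (rule order.trans)
    with f[of x] \<open>d > 0\<close> show False by (simp add: entry)
  qed
  with that show ?thesis by blast
qed

section \<open>The dimension count\<close>

lemma card_le_of_concentrated:
  assumes s: "\<And>A. quasi_local (1 / 4) s (\<lambda>g. U (proj A (V g)))"
    and fin: "finite A" "finite B"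
    and sep: "\<And>y z. y \<in> B \<Longrightarrow> dist y z \<le> s \<Longrightarrow> z \<in> B"
    and conc: "\<And>x. x \<in> A \<Longrightarrow> norm (proj (- B) (U (delta x))) \<le> 1 / 2"
  shows "card A \<le> card B"
proof (rule ccontr)
  assume "\<not> card A \<le> card B"
  then obtain c where c: "\<exists>x\<in>A. c x \<noteq> 0"
    "\<And>y. y \<in> B \<Longrightarrow> (\<Sum>x\<in>A. c x * ell2_fun (U (delta x)) y) = 0"
    using underdetermined_system[OF fin(2,1), of "\<lambda>y x. ell2_fun (U (delta x)) y"] by auto
  define v where "v = (\<Sum>x\<in>A. scaleC (c x) (delta x))"
  have U0: "U 0 = 0" using U_add[of 0 0] by simp
  have v: "ell2_fun v z = (if z \<in> A then c z else 0)" for z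
    unfolding v_def by (rule ell2_fun_sum_delta[OF fin(1)])
  have Uv: "ell2_fun (U v) y = (\<Sum>x\<in>A. c x * ell2_fun (U (delta x)) y)" for y
    unfolding v_def using fin(1) by (induction A rule: finite_induct) (auto simp: U0 U_add U_scaleC)
  have "v \<noteq> 0"
  proof
    assume "v = 0"
    then have "ell2_fun v z = 0" for z by simp
    with c(1) show False unfolding v by metis
  qed
  have supp: "proj A v = v" by (rule ell2_eqI) (auto simp: v)
  have kernel: "proj (- B) (U v) = U v" by (rule ell2_eqI) (auto simp: Uv c(2))
  obtain S where S: "S \<subseteq> A"
    "(\<Sum>x\<in>A. (cmod (ell2_fun v x))\<^sup>2 * (norm (proj B (U (delta x))))\<^sup>2) \<le>
      (norm (proj B (U (proj S v)) - proj B (U (proj (A - S) v))))\<^sup>2"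
    using exists_signs_proj[OF fin(1), of "\<lambda>f. proj B (U f)" v]
    by (auto simp: U_add U_scaleC proj_add proj_scaleC)
  \<comment> \<open>The constant \<open>3 / 4 = 1 - (1 / 2)\<^sup>2\<close> bounds from below the
    squared norm that each \<open>U (delta x)\<close> keeps on \<open>B\<close>.\<close>
  have "3 / 4 * (norm v)\<^sup>2 = (\<Sum>x\<in>A. (cmod (ell2_fun v x))\<^sup>2 * (3 / 4))"
    using norm_proj_finite[OF fin(1), of v] by (simp add: supp sum_distrib_right[symmetric] sum_divide_distrib[symmetric])
  also have "\<dots> \<le> (\<Sum>x\<in>A. (cmod (ell2_fun v x))\<^sup>2 * (norm (proj B (U (delta x))))\<^sup>2)"
  proof (intro sum_mono mult_left_mono)
    fix x assume "x \<in> A"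
    then have "(norm (proj (- B) (U (delta x))))\<^sup>2 \<le> (1 / 2)\<^sup>2"
      using conc by (intro power_mono) auto
    then show "3 / 4 \<le> (norm (proj B (U (delta x))))\<^sup>2"
      using norm_proj_Pythagoras[of "U (delta x)" B] by (simp add: power2_eq_square)
  qed simp
  also note S(2)
  also have "(norm (proj B (U (proj S v)) - proj B (U (proj (A - S) v))))\<^sup>2 \<le> (1 / 2 * norm v)\<^sup>2"
  proof (intro power_mono)
    \<comment> \<open>\<open>U v\<close> lives on \<open>- B\<close>, whose points are by
      \<open>sep\<close> further than \<open>s\<close> from \<open>B\<close>. The resulting squared
      bound 1/4 contradicts 3/4.\<close>
    have "norm (proj B (U (proj S (V (proj (- B) (U v))) - proj (A - S) (V (proj (- B) (U v)))))) \<le>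
        2 * (1 / 4) * norm (U v)"
      by (rule quasi_localD[OF quasi_local_signs[OF s]]) (use sep not_less in blast)
    then show "norm (proj B (U (proj S v)) - proj B (U (proj (A - S) v))) \<le> 1 / 2 * norm v"
      by (simp add: kernel U_diff proj_diff)
  qed simp
  finally show False using \<open>v \<noteq> 0\<close> by (simp add: power_mult_distrib power2_eq_square)
qed

end

section \<open>Matching the pieces of coarse disjoint unions\<close>

definition isolated_piece :: "(nat \<Rightarrow> 'a::metric_space set) \<Rightarrow> real \<Rightarrow> nat \<Rightarrow> bool" where
  "isolated_piece X s n \<longleftrightarrow> (\<forall>x\<in>X n. \<forall>z. dist x z \<le> s \<longrightarrow> z \<in> X n)"

lemma isolated_pieceD: "isolated_piece X s n \<Longrightarrow> x \<in> X n \<Longrightarrow> dist x z \<le> s \<Longrightarrow> z \<in> X n"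
  unfolding isolated_piece_def by blast

text \<open>A point of \<open>X n\<close> with an \<open>s\<close>-neighbour outside yields a pair
  of distinct pieces at distance at most \<open>s\<close>, and such pairs are finite in
  number.\<close>

lemma finite_not_isolated_piece:
  assumes "coarse_disjoint_union X"
  shows "finite {n. \<not> isolated_piece X s n}"
proof (rule finite_subset)
  show "finite (fst ` {(n, m). n \<noteq> m \<and> \<not> setdist (X n) (X m) > s})"
    using assms by (auto simp: coarse_disjoint_union_def)
  show "{n. \<not> isolated_piece X s n} \<subseteq> fst ` {(n, m). n \<noteq> m \<and> \<not> setdist (X n) (X m) > s}"
  proof
    fix n assume "n \<in> {n. \<not> isolated_piece X s n}"
    then obtain x z where x: "x \<in> X n" "dist x z \<le> s" "z \<notin> X n"
      unfolding isolated_piece_def by blast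
    have "z \<in> (\<Union>n. X n)" using assms by (simp add: coarse_disjoint_union_def)
    then obtain m where "z \<in> X m" by blast
    with x have "n \<noteq> m" "setdist (X n) (X m) \<le> s"
      using setdist_le_dist[of x "X n" z "X m"] by auto
    then show "n \<in> fst ` {(n, m). n \<noteq> m \<and> \<not> setdist (X n) (X m) > s}"
      by (intro image_eqI[of _ _ "(n, m)"]) auto
  qed
qed

text \<open>A chain of \<open>t\<close>-steps in \<open>S\<close> goes to a chain of
  \<open>s\<close>-steps, which cannot leave an isolated piece.\<close>

lemma t_connected_image_subset:
  assumes "t_connected t S" "x \<in> S" "h x \<in> Z m" "isolated_piece Z s m"
    and step: "\<And>x x'. dist x x' \<le> t \<Longrightarrow> dist (h x) (h x') \<le> s"
  shows "h ` S \<subseteq> Z m"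
proof (rule image_subsetI)
  fix x' assume "x' \<in> S"
  then obtain n :: nat and p where p: "p 0 = x" "p n = x'"
    "\<And>i. i \<in> {1..n} \<Longrightarrow> dist (p (i - 1)) (p i) \<le> t"
    using assms(1,2) unfolding t_connected_def by metis
  have "h (p i) \<in> Z m" if "i \<le> n" for i
    using that
  proof (induction i)
    case 0
    then show ?case using p(1) assms(3) by simp
  next
    case (Suc i)
    then have "dist (h (p i)) (h (p (Suc i))) \<le> s"
      using p(3)[of "Suc i"] by (intro step) simp
    with Suc isolated_pieceD[OF assms(4)] show ?case by simp
  qed
  from this[of n] show "h x' \<in> Z m" by (simp add: p(2))
qed

text \<open>The metric part of the proof, freed from operators: \<open>card_le\<close> is the
  dimension count, and one constant \<open>s\<close> serves at every scale.\<close>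

locale matched_pieces =
  fixes X :: "nat \<Rightarrow> 'a::metric_space set" and Y :: "nat \<Rightarrow> 'b::metric_space set"
    and f :: "'a \<Rightarrow> 'b" and g :: "'b \<Rightarrow> 'a" and s t :: real
  assumes X: "coarse_disjoint_union X" "\<And>n. X n \<noteq> {} \<and> t_connected t (X n)"
    and Y: "coarse_disjoint_union Y" "\<And>n. Y n \<noteq> {} \<and> t_connected t (Y n)"
    and finite_ball: "\<And>x::'a. finite (cball x s)" "\<And>y::'b. finite (cball y s)"
    and step: "\<And>x x'. dist x x' \<le> t \<Longrightarrow> dist (f x) (f x') \<le> s"
      "\<And>y y'. dist y y' \<le> t \<Longrightarrow> dist (g y) (g y') \<le> s"
    and inverse: "\<And>x. dist (g (f x)) x \<le> s" "\<And>y. dist (f (g y)) y \<le> s"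
    and card_le: "\<And>A B. \<lbrakk>finite A; finite B; \<And>y z. y \<in> B \<Longrightarrow> dist y z \<le> s \<Longrightarrow> z \<in> B; f ` A \<subseteq> B\<rbrakk>
        \<Longrightarrow> card A \<le> card B"
      "\<And>A B. \<lbrakk>finite B; finite A; \<And>x z. x \<in> A \<Longrightarrow> dist x z \<le> s \<Longrightarrow> z \<in> A; g ` B \<subseteq> A\<rbrakk>
        \<Longrightarrow> card B \<le> card A"
begin

lemma swap: "matched_pieces Y X g f s t"
  by unfold_locales (fact X Y finite_ball step inverse card_le)+

lemma finite_X: "finite (X n)"
  and ex_X: "\<exists>n. x \<in> X n"
  and X_disjoint: "x \<in> X n \<Longrightarrow> x \<in> X m \<Longrightarrow> n = m"
  using X(1) unfolding coarse_disjoint_union_def disjoint_family_on_def by blast+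

text \<open>Isolation is demanded on both sides so that the relation becomes symmetric under
  exchanging \<open>X\<close> and \<open>Y\<close>, see \<open>matched_swap\<close>.\<close>

definition matched :: "nat \<Rightarrow> nat \<Rightarrow> bool" where
  "matched n m \<longleftrightarrow> isolated_piece X s n \<and> isolated_piece Y s m \<and> f ` X n \<subseteq> Y m"

text \<open>One point suffices: \<open>g (f x)\<close> stays within \<open>s\<close> of
  \<open>x\<close>, hence in \<open>X n\<close>, and connectedness spreads this over
  \<open>Y m\<close>.\<close>

lemma matched_inverse: "matched n m \<Longrightarrow> g ` Y m \<subseteq> X n"
proof -
  assume m: "matched n m"
  obtain x where x: "x \<in> X n" using X(2)[of n] by blast
  then have "f x \<in> Y m" "g (f x) \<in> X n"
    using m inverse(1)[of x] isolated_pieceD[of X s n x "g (f x)"]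
    by (auto simp: matched_def dist_commute)
  with m show ?thesis
    using t_connected_image_subset[of t "Y m" "f x" g X n s] Y(2) step(2) by (auto simp: matched_def)
qed

lemma matched_unique: "matched n m \<Longrightarrow> matched n m' \<Longrightarrow> m = m'"
proof -
  assume m: "matched n m" "matched n m'"
  obtain x where "x \<in> X n" using X(2)[of n] by blast
  with m have "f x \<in> Y m" "f x \<in> Y m'" by (auto simp: matched_def)
  then show "m = m'"
    using Y(1) unfolding coarse_disjoint_union_def disjoint_family_on_def by blast
qed

text \<open>If \<open>X n\<close> is isolated but unmatched, \<open>f\<close> sends its points into
  the finitely many pieces of \<open>Y\<close> that are not isolated. As \<open>g\<close>
  approximately inverts \<open>f\<close>, these points lie in the finite set \<open>H\<close>, which
  meets only finitely many pieces.\<close>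

lemma finite_unmatched: "finite {n. \<nexists>m. matched n m}"
proof -
  define F where "F = (\<Union>m\<in>{m. \<not> isolated_piece Y s m}. Y m)"
  define H where "H = (\<Union>y\<in>F. cball (g y) s)"
  have "finite F"
    unfolding F_def using finite_not_isolated_piece[OF Y(1)] Y(1)
    by (auto simp: coarse_disjoint_union_def)
  then have "finite H" unfolding H_def using finite_ball by blast
  have "n \<in> {n. \<not> isolated_piece X s n} \<union> (\<lambda>x. THE n. x \<in> X n) ` H" if un: "\<nexists>m. matched n m" for n
  proof (cases "isolated_piece X s n")
    case True
    obtain x where x: "x \<in> X n" using X(2)[of n] by blast
    have "f x \<in> (\<Union>m. Y m)" using Y(1) by (simp add: coarse_disjoint_union_def)
    then obtain m where m: "f x \<in> Y m" by blast
    have "\<not> isolated_piece Y s m"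
      using t_connected_image_subset[of t "X n" x f Y m s] True un m x X(2) step(1)
      by (auto simp: matched_def)
    with m have "f x \<in> F" by (auto simp: F_def)
    with inverse(1)[of x] have "x \<in> H" by (auto simp: H_def)
    moreover have "(THE n. x \<in> X n) = n" using x X_disjoint by blast
    ultimately show ?thesis by (metis UnI2 imageI)
  qed simp
  then have "{n. \<nexists>m. matched n m} \<subseteq> {n. \<not> isolated_piece X s n} \<union> (\<lambda>x. THE n. x \<in> X n) ` H"
    by blast
  then show ?thesis
    by (rule finite_subset) (use finite_not_isolated_piece[OF X(1)] \<open>finite H\<close> in simp)
qed

end

sublocale matched_pieces \<subseteq> sw: matched_pieces Y X g f s t
  by (rule swap)

context matched_pieces
begin

lemma matched_swap: "sw.matched m n \<longleftrightarrow> matched n m"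
  using matched_inverse[of n m] sw.matched_inverse[of m n]
  unfolding matched_def sw.matched_def by blast

lemma card_matched_le: "matched n m \<Longrightarrow> card (X n) \<le> card (Y m)"
  by (rule card_le(1)[OF finite_X sw.finite_X])
    (simp_all add: matched_def isolated_pieceD[of Y s m])

text \<open>The dimension count for the whole unmatched parts. Matched pieces are isolated, so no
  point of an unmatched piece of \<open>Y\<close> has an \<open>s\<close>-neighbour in one; and
  \<open>f x\<close> in a matched piece would force \<open>x\<close> into its partner via
  \<open>g\<close>.\<close>

lemma card_unmatched_le:
  "card (\<Union>n\<in>{n. \<nexists>m. matched n m}. X n) \<le> card (\<Union>m\<in>{m. \<nexists>n. matched n m}. Y m)"
proof (rule card_le(1))
  show "finite (\<Union>n\<in>{n. \<nexists>m. matched n m}. X n)"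
    using finite_unmatched finite_X by blast
  show "finite (\<Union>m\<in>{m. \<nexists>n. matched n m}. Y m)"
    using sw.finite_unmatched sw.finite_X by (simp add: matched_swap)
  show "z \<in> (\<Union>m\<in>{m. \<nexists>n. matched n m}. Y m)"
    if y: "y \<in> (\<Union>m\<in>{m. \<nexists>n. matched n m}. Y m)" "dist y z \<le> s" for y z
  proof -
    obtain m where m: "y \<in> Y m" "\<nexists>n. matched n m" using y by blast
    obtain m' where m': "z \<in> Y m'" using sw.ex_X by blast
    have "\<nexists>n. matched n m'"
    proof
      assume ex: "\<exists>n. matched n m'"
      then have "isolated_piece Y s m'" by (auto simp: matched_def)
      then have "y \<in> Y m'" using m' y(2) by (metis isolated_pieceD dist_commute)
      then have "m' = m" using sw.X_disjoint m(1) by blast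
      with ex m(2) show False by blast
    qed
    with m' show ?thesis by blast
  qed
  show "f ` (\<Union>n\<in>{n. \<nexists>m. matched n m}. X n) \<subseteq> (\<Union>m\<in>{m. \<nexists>n. matched n m}. Y m)"
  proof (rule image_subsetI)
    fix x assume "x \<in> (\<Union>n\<in>{n. \<nexists>m. matched n m}. X n)"
    then obtain n where n: "x \<in> X n" "\<nexists>m. matched n m" by blast
    obtain m where m: "f x \<in> Y m" using sw.ex_X by blast
    have "\<nexists>n. matched n m"
    proof
      assume "\<exists>n. matched n m"
      then obtain n' where n': "matched n' m" ..
      then have "g (f x) \<in> X n'" using matched_inverse m by blast
      then have "x \<in> X n'"
        using n' inverse(1)[of x] by (auto simp: matched_def intro: isolated_pieceD)
      then have "n' = n" using X_disjoint n(1) by blast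
      with n' n(2) show False by blast
    qed
    with m show "f x \<in> (\<Union>m\<in>{m. \<nexists>n. matched n m}. Y m)" by blast
  qed
qed

lemma card_unmatched: "card (\<Union>n\<in>{n. \<nexists>m. matched n m}. X n) = (\<Sum>n\<in>{n. \<nexists>m. matched n m}. card (X n))"
  using finite_unmatched finite_X X_disjoint by (intro card_UN_disjoint) auto

end

context matched_pieces
begin

lemma matching:
  "\<exists>N M i. finite (- N) \<and> finite (- M) \<and> bij_betw i N M \<and>
    (\<Sum>n\<in>- N. card (X n)) = (\<Sum>n\<in>- M. card (Y n)) \<and>
    (\<forall>n\<in>N. card (X n) = card (Y (i n)) \<and> f ` X n \<subseteq> Y (i n))"
proof -
  define N where "N = {n. \<exists>m. matched n m}"
  define M where "M = {m. \<exists>n. matched n m}"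
  have "\<exists>i. \<forall>n\<in>N. matched n (i n)" unfolding N_def by (rule bchoice) simp
  then obtain i where i: "\<And>n. n \<in> N \<Longrightarrow> matched n (i n)" by blast
  have compl: "- N = {n. \<nexists>m. matched n m}" "- M = {m. \<nexists>n. matched n m}"
    by (auto simp: N_def M_def)
  have uniq: "n = n'" if "matched n m" "matched n' m" for n n' m
    using sw.matched_unique[of m n n'] that by (simp add: matched_swap)
  have "bij_betw i N M"
    unfolding bij_betw_def
  proof
    show "inj_on i N" using i uniq by (metis inj_onI)
    show "i ` N = M"
    proof
      show "i ` N \<subseteq> M" using i by (auto simp: M_def)
      show "M \<subseteq> i ` N"
      proof
        fix m assume "m \<in> M"
        then obtain n where n: "matched n m" by (auto simp: M_def)
        then have "n \<in> N" by (auto simp: N_def)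
        then show "m \<in> i ` N" using matched_unique[OF n i] by blast
      qed
    qed
  qed
  moreover have "finite (- N)" "finite (- M)"
    using finite_unmatched sw.finite_unmatched by (simp_all add: compl matched_swap)
  moreover have "(\<Sum>n\<in>- N. card (X n)) = (\<Sum>n\<in>- M. card (Y n))"
    using card_unmatched_le sw.card_unmatched_le card_unmatched sw.card_unmatched
    by (simp add: compl matched_swap)
  moreover have "card (X n) = card (Y (i n)) \<and> f ` X n \<subseteq> Y (i n)" if "n \<in> N" for n
    using i[OF that] card_matched_le[of n "i n"] sw.card_matched_le[of "i n" n]
    by (auto simp: matched_swap) (auto simp: matched_def)
  ultimately show ?thesis by blast
qed

end

section \<open>From isomorphisms to coarse equivalences\<close>

text \<open>The usual spatial implementation: \<open>\<phi>\<close> maps a rank one projection to a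
  projection fixing some unit vector \<open>\<xi>\<close>, and the images of the operators
  \<open>rank1 f \<delta>\<close> acting on \<open>\<xi>\<close> define the unitary.\<close>

lemma star_isomorphism_roe_unitary:
  fixes \<phi> :: "'a::metric_space op \<Rightarrow> 'b::metric_space op"
  assumes ulf: "uniformly_locally_finite (UNIV :: 'a set)" "uniformly_locally_finite (UNIV :: 'b set)"
    and iso: "star_isomorphism uniform_Roe_algebra uniform_Roe_algebra \<phi>"
  obtains U V where "roe_unitary (U :: 'a ell2 \<Rightarrow> 'b ell2) V"
proof -
  have bij: "bij_betw \<phi> uniform_Roe_algebra uniform_Roe_algebra"
    and phi_add: "\<And>a b. a \<in> uniform_Roe_algebra \<Longrightarrow> b \<in> uniform_Roe_algebra \<Longrightarrow> \<phi> (a + b) = \<phi> a + \<phi> b"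
    and phi_scale: "\<And>c a. a \<in> uniform_Roe_algebra \<Longrightarrow> \<phi> (op_scaleC c a) = op_scaleC c (\<phi> a)"
    and phi_mult: "\<And>a b. a \<in> uniform_Roe_algebra \<Longrightarrow> b \<in> uniform_Roe_algebra \<Longrightarrow>
      \<phi> (a o\<^sub>L b) = \<phi> a o\<^sub>L \<phi> b"
    and phi_adj: "\<And>a. a \<in> uniform_Roe_algebra \<Longrightarrow> \<phi> (adjoint_op a) = adjoint_op (\<phi> a)"
    using iso unfolding star_isomorphism_def by blast+
  have phi_in: "\<phi> a \<in> uniform_Roe_algebra" if "a \<in> uniform_Roe_algebra" for a
    using bij that by (auto simp: bij_betw_def)
  have phi_surj: "\<exists>a\<in>uniform_Roe_algebra. \<phi> a = b" if "b \<in> uniform_Roe_algebra" for b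
    using bij that unfolding bij_betw_def by (metis imageE)
  define \<delta> where "\<delta> = delta (undefined :: 'a)"
  define e where "e = rank1 \<delta> \<delta>"
  have e: "e \<in> uniform_Roe_algebra" "e o\<^sub>L e = e"
    by (simp_all add: e_def rank1_in_Roe rank1_compose_rank1 \<delta>_def)
  \<comment> \<open>Otherwise \<open>e + e\<close> and \<open>e\<close> would have the same image,
    and injectivity would force \<open>e = 0\<close>.\<close>
  have "\<phi> e \<noteq> 0"
  proof
    assume "\<phi> e = 0"
    then have "\<phi> (e + e) = \<phi> e" using phi_add[OF e(1) e(1)] by simp
    moreover have "e + e = rank1 (\<delta> + \<delta>) \<delta>" by (simp add: e_def rank1_add)
    ultimately have "e + e = e"
      using bij e(1) rank1_in_Roe[of "\<delta> + \<delta>" \<delta>] by (auto simp: bij_betw_def inj_on_def)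
    then have "blinfun_apply e \<delta> = 0" by simp
    then have "norm (blinfun_apply e \<delta>) = 0" by (simp only: norm_zero)
    then show False by (simp add: e_def \<delta>_def)
  qed
  then obtain \<eta> where \<eta>: "blinfun_apply (\<phi> e) \<eta> \<noteq> 0"
    by (metis blinfun_eqI zero_blinfun.rep_eq)
  define \<xi> where "\<xi> = blinfun_apply (\<phi> e) \<eta> /\<^sub>R norm (blinfun_apply (\<phi> e) \<eta>)"
  have "blinfun_apply (\<phi> e) (blinfun_apply (\<phi> e) \<eta>) = blinfun_apply (\<phi> e) \<eta>"
    using phi_mult[OF e(1) e(1)] by (simp add: e(2) blinfun_apply_blinfun_compose[symmetric])
  then have \<xi>: "blinfun_apply (\<phi> e) \<xi> = \<xi>" "norm \<xi> = 1"
    using \<eta> by (simp_all add: \<xi>_def blinfun.scaleR_right)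
  \<comment> \<open>\<open>\<phi> e\<close> is a rank one projection onto the line through \<open>\<xi>\<close>, and \<open>rank1 f \<delta>\<close> moves \<open>\<delta>\<close> to \<open>f\<close>.\<close>
  define U where "U f = blinfun_apply (\<phi> (rank1 f \<delta>)) \<xi>" for f
  have U_add: "U (f + f') = U f + U f'" for f f'
    by (simp add: U_def rank1_add phi_add rank1_in_Roe blinfun.add_left)
  have U_scale: "U (scaleC c f) = scaleC c (U f)" for c f
    by (simp add: U_def rank1_scaleC phi_scale rank1_in_Roe op_scaleC_apply)
  \<comment> \<open>Multiplying \<open>rank1 f \<delta>\<close> by \<open>a\<close> replaces
    \<open>f\<close> by its image under \<open>a\<close>, so multiplicativity of
    \<open>\<phi>\<close> becomes an intertwining relation.\<close>
  have inter: "blinfun_apply (\<phi> a) (U f) = U (blinfun_apply a f)" if "a \<in> uniform_Roe_algebra" for a f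
    using phi_mult[OF that rank1_in_Roe, of f \<delta>]
    by (simp add: U_def blinfun_compose_rank1 Roe_bounded[OF that])
  \<comment> \<open>Moved to the other side, \<open>\<phi> (rank1 f \<delta>)\<close> becomes
    \<open>\<phi> (rank1 \<delta> f)\<close>, which sends \<open>U f'\<close> to a scalar multiple
    of \<open>\<xi>\<close>.\<close>
  have U_cinner: "cinner (U f) (U f') = cinner f f'" for f f'
  proof -
    have "cinner (U f) (U f') =
        cinner \<xi> (blinfun_apply (adjoint_op (\<phi> (rank1 f \<delta>))) (U f'))"
      unfolding U_def[of f] by (rule cinner_adjoint_op) (intro Roe_bounded phi_in rank1_in_Roe)
    also have "adjoint_op (\<phi> (rank1 f \<delta>)) = \<phi> (rank1 \<delta> f)"
      by (simp add: phi_adj[symmetric] rank1_in_Roe adjoint_rank1)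
    also have "blinfun_apply (\<phi> (rank1 \<delta> f)) (U f') = scaleC (cinner f' f) (U \<delta>)"
      by (simp add: inter rank1_in_Roe U_scale)
    also have "U \<delta> = \<xi>" using \<xi> by (simp add: U_def e_def)
    finally show ?thesis
      by (simp add: cinner_scaleC_right cinner_self \<xi> cinner_commute[of f f'])
  qed
  have "inj U"
    by (rule injI, rule cinner_eqI) (metis U_cinner)
  have "surj U"
    unfolding surj_def
  proof
    fix h
    \<comment> \<open>Since \<open>\<xi> = U \<delta>\<close>, the preimage of
      \<open>rank1 h \<xi>\<close> moves \<open>\<delta>\<close> to a vector that \<open>U\<close>
      sends to \<open>h\<close>.\<close>
    obtain a where a: "a \<in> uniform_Roe_algebra" "\<phi> a = rank1 h \<xi>"
      using phi_surj[OF rank1_in_Roe] by blast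
    have "h = blinfun_apply (\<phi> a) (U \<delta>)"
      using \<xi> by (simp add: a(2) U_def e_def[symmetric] cinner_self)
    then show "\<exists>f. h = U f" using inter[OF a(1)] by auto
  qed
  define V where "V = inv U"
  have UV: "U (V g) = g" for g using \<open>surj U\<close> by (simp add: V_def surj_f_inv_f)
  have VU: "V (U f) = f" for f using \<open>inj U\<close> by (simp add: V_def inv_f_f)
  have "roe_unitary U V"
  proof
    show "V (g + g') = V g + V g'" for g g' by (metis UV VU U_add)
    show "V (scaleC c g) = scaleC c (V g)" for c g by (metis UV VU U_scale)
    show "cinner (U f) g = cinner f (V g)" for f g by (metis UV U_cinner)
    show "\<exists>s. quasi_local \<epsilon> s (\<lambda>g. U (proj A (V g)))" if "0 < \<epsilon>" for \<epsilon> A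
    proof -
      have "(\<lambda>g. U (proj A (V g))) = blinfun_apply (\<phi> (proj_op A))"
      proof
        show "U (proj A (V g)) = blinfun_apply (\<phi> (proj_op A)) g" for g
          using inter[OF proj_op_in_Roe, of A "V g"] by (simp add: UV)
      qed
      then show ?thesis
        using Roe_quasi_local[OF phi_in[OF proj_op_in_Roe] that, of A] by metis
    qed
    show "\<exists>s. quasi_local \<epsilon> s (\<lambda>f. V (proj B (U f)))" if "0 < \<epsilon>" for \<epsilon> B
    proof -
      \<comment> \<open>Quasi-locality is needed on the first space here, so the projection is
        pulled back through \<open>\<phi>\<close>.\<close>
      obtain a where a: "a \<in> uniform_Roe_algebra" "\<phi> a = proj_op B"
        using phi_surj[OF proj_op_in_Roe] by blast
      have "(\<lambda>f. V (proj B (U f))) = blinfun_apply a"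
      proof
        show "V (proj B (U f)) = blinfun_apply a f" for f
          using inter[OF a(1), of f] by (simp add: a(2) VU)
      qed
      then show ?thesis using Roe_quasi_local[OF a(1) that] by metis
    qed
    show "\<exists>(W :: 'a op) (T :: 'b op). (\<forall>f. blinfun_apply T (U f) = U (blinfun_apply W f)) \<and>
      (\<forall>x z. dist x z \<le> r \<longrightarrow> ell2_fun (blinfun_apply W (delta x)) z = 1) \<and>
      (\<forall>e>0. \<exists>s. quasi_local e s (blinfun_apply T))" for r
    proof -
      obtain W :: "'a op" where W: "W \<in> uniform_Roe_algebra"
        "\<And>x z. dist x z \<le> r \<Longrightarrow> ell2_fun (blinfun_apply W (delta x)) z = 1"
        using Roe_element_connecting_neighbours[OF ulf(1), of r] by blast
      have "\<exists>s. quasi_local e s (blinfun_apply (\<phi> W))" if "e > 0" for e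
        using Roe_quasi_local[OF phi_in[OF W(1)] that] by metis
      then show ?thesis using W inter[OF W(1)] by (intro exI[of _ W] exI[of _ "\<phi> W"]) auto
    qed
    show "\<exists>(W :: 'b op) (T :: 'a op). (\<forall>g. blinfun_apply T (V g) = V (blinfun_apply W g)) \<and>
      (\<forall>y z. dist y z \<le> r \<longrightarrow> ell2_fun (blinfun_apply W (delta y)) z = 1) \<and>
      (\<forall>e>0. \<exists>s. quasi_local e s (blinfun_apply T))" for r
    proof -
      obtain W :: "'b op" where W: "W \<in> uniform_Roe_algebra"
        "\<And>y z. dist y z \<le> r \<Longrightarrow> ell2_fun (blinfun_apply W (delta y)) z = 1"
        using Roe_element_connecting_neighbours[OF ulf(2), of r] by blast
      obtain a where a: "a \<in> uniform_Roe_algebra" "\<phi> a = W" using phi_surj[OF W(1)] by blast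
      have "blinfun_apply a (V g) = V (blinfun_apply W g)" for g
        using inter[OF a(1), of "V g"] by (simp add: a(2) UV VU)
      moreover have "\<exists>s. quasi_local e s (blinfun_apply a)" if "e > 0" for e
        using Roe_quasi_local[OF a(1) that] by metis
      ultimately show ?thesis using W by (intro exI[of _ W] exI[of _ a]) auto
    qed
  qed (fact ulf U_add U_scale UV VU)+
  then show ?thesis by (rule that)
qed

section \<open>Common constants and the final assembly\<close>

lemma coarse_mapI:
  assumes "\<And>r. \<exists>R. \<forall>x z. dist x z \<le> r \<longrightarrow> dist (f x) (f z) \<le> R"
  shows "coarse_map f"
  unfolding coarse_map_def
proof (intro allI impI)
  fix r :: real
  obtain R where R: "\<And>x z. dist x z \<le> r \<Longrightarrow> dist (f x) (f z) \<le> R"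
    using assms by metis
  have "dist (f x) (f z) < max R 0 + 1" if "dist x z < r" for x z
    using R[of x z] that by linarith
  then show "\<exists>s>0. \<forall>x z. dist x z < r \<longrightarrow> dist (f x) (f z) < s"
    by (intro exI[of _ "max R 0 + 1"]) auto
qed

context roe_unitary
begin

text \<open>The cardinality bound is stated for every \<open>s\<close> above the constant, so that
  the constants for \<open>f\<close> and for \<open>g\<close> can be merged into their
  maximum.\<close>

lemma localisation_properties:
  assumes d: "d > 0" "\<And>x. d \<le> cmod (ell2_fun (U (delta x)) (f x))"
    and d': "d' > 0" "\<And>y. d' \<le> cmod (ell2_fun (V (delta y)) (g y))"
  obtains s\<^sub>0 where "\<And>x. dist (g (f x)) x \<le> s\<^sub>0" "\<And>x x'. dist x x' \<le> t \<Longrightarrow> dist (f x) (f x') \<le> s\<^sub>0"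
    "\<And>s. s\<^sub>0 \<le> s \<Longrightarrow> \<forall>A B. finite A \<longrightarrow> finite B \<longrightarrow> (\<forall>y\<in>B. \<forall>z. dist y z \<le> s \<longrightarrow> z \<in> B) \<longrightarrow> f ` A \<subseteq> B \<longrightarrow>
      card A \<le> card B"
proof -
  obtain s\<^sub>1 where s\<^sub>1: "\<And>x. dist (g (f x)) x \<le> s\<^sub>1"
    using localisation_inverse[OF d d'] by blast
  obtain s\<^sub>2 where s\<^sub>2: "\<And>x x'. dist x x' \<le> t \<Longrightarrow> dist (f x) (f x') \<le> s\<^sub>2"
    using localisation_coarse[OF d] by blast
  obtain s\<^sub>3 where s\<^sub>3: "\<And>x. norm (proj (- cball (f x) s\<^sub>3) (U (delta x))) \<le> 1 / 2"
    using U_delta_concentrated[OF d, of "1 / 2"] by auto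
  obtain s\<^sub>4 where s\<^sub>4: "\<And>A. quasi_local (1 / 4) s\<^sub>4 (\<lambda>g. U (proj A (V g)))"
    using uniformly_quasi_local[of "1 / 4"] by auto
  define s\<^sub>0 where "s\<^sub>0 = Max {s\<^sub>1, s\<^sub>2, s\<^sub>3, s\<^sub>4}"
  have s\<^sub>0: "s\<^sub>1 \<le> s\<^sub>0" "s\<^sub>2 \<le> s\<^sub>0" "s\<^sub>3 \<le> s\<^sub>0" "s\<^sub>4 \<le> s\<^sub>0" by (simp_all add: s\<^sub>0_def)
  show ?thesis
  proof
    show "dist (g (f x)) x \<le> s\<^sub>0" for x using s\<^sub>1 s\<^sub>0(1) by (rule order.trans)
    show "dist (f x) (f x') \<le> s\<^sub>0" if "dist x x' \<le> t" for x x'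
      using s\<^sub>2[OF that] s\<^sub>0(2) by (rule order.trans)
    show "\<forall>A B. finite A \<longrightarrow> finite B \<longrightarrow> (\<forall>y\<in>B. \<forall>z. dist y z \<le> s \<longrightarrow> z \<in> B) \<longrightarrow> f ` A \<subseteq> B \<longrightarrow>
      card A \<le> card B" if le: "s\<^sub>0 \<le> s" for s
    proof (intro allI impI)
      fix A :: "'a set" and B :: "'b set"
      assume fin: "finite A" "finite B" and sep: "\<forall>y\<in>B. \<forall>z. dist y z \<le> s \<longrightarrow> z \<in> B"
        and sub: "f ` A \<subseteq> B"
      show "card A \<le> card B"
      proof (rule card_le_of_concentrated[OF s\<^sub>4 fin])
        show "z \<in> B" if "y \<in> B" "dist y z \<le> s\<^sub>4" for y z
        proof -
          have "dist y z \<le> s" using that(2) s\<^sub>0(4) le by linarith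
          with sep that(1) show ?thesis by blast
        qed
        fix x assume "x \<in> A"
        have "z \<in> B" if "z \<in> cball (f x) s\<^sub>3" for z
        proof -
          have "dist (f x) z \<le> s" using that s\<^sub>0(3) le by simp
          with sep sub \<open>x \<in> A\<close> show ?thesis by blast
        qed
        then have far: "- B \<subseteq> - cball (f x) s\<^sub>3" by blast
        show "norm (proj (- B) (U (delta x))) \<le> 1 / 2"
          using norm_proj_mono[OF far] s\<^sub>3[of x] by (rule order.trans)
      qed
    qed
  qed
qed

end

theorem theorem4p1:
  fixes t :: real
    and X :: "nat \<Rightarrow> 'a::metric_space set"
    and Y :: "nat \<Rightarrow> 'b::metric_space set"
  assumes "t > 0"
    and "uniformly_locally_finite (UNIV :: 'a set)"
    and "uniformly_locally_finite (UNIV :: 'b set)"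
    and "coarse_disjoint_union X"
    and "coarse_disjoint_union Y"
    and "\<And>n. X n \<noteq> {} \<and> t_connected t (X n)"
    and "\<And>n. Y n \<noteq> {} \<and> t_connected t (Y n)"
    and "star_isomorphic (uniform_Roe_algebra :: 'a op set) (uniform_Roe_algebra :: 'b op set)"
  shows "\<exists>(N :: nat set) (M :: nat set) (i :: nat \<Rightarrow> nat) (f :: 'a \<Rightarrow> 'b).
    finite (- N) \<and> finite (- M) \<and> bij_betw i N M \<and> coarse_equivalence f \<and>
    (\<Sum>n\<in>- N. card (X n)) = (\<Sum>n\<in>- M. card (Y n)) \<and>
    (\<forall>n\<in>N. card (X n) = card (Y (i n)) \<and> f ` X n \<subseteq> Y (i n))"
proof -
  obtain \<phi> where "star_isomorphism (uniform_Roe_algebra :: 'a op set) (uniform_Roe_algebra :: 'b op set) \<phi>"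
    using assms(8) unfolding star_isomorphic_def by blast
  then obtain U :: "'a ell2 \<Rightarrow> 'b ell2" and V where UV: "roe_unitary U V"
    using star_isomorphism_roe_unitary[OF assms(2,3)] by blast
  interpret U: roe_unitary U V by (rule UV)
  interpret V: roe_unitary V U by (rule U.swap)
  obtain d where d: "d > 0" "\<And>x. \<exists>y. d \<le> cmod (ell2_fun (U (delta x)) y)"
    by (rule U.U_delta_not_spread) (rule that)
  obtain d' where d': "d' > 0" "\<And>y. \<exists>x. d' \<le> cmod (ell2_fun (V (delta y)) x)"
    by (rule V.U_delta_not_spread) (rule that)
  obtain f where f: "\<And>x. d \<le> cmod (ell2_fun (U (delta x)) (f x))" using d(2) by metis
  obtain g where g: "\<And>y. d' \<le> cmod (ell2_fun (V (delta y)) (g y))" using d'(2) by metis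
  obtain s\<^sub>1 where s\<^sub>1: "\<And>x. dist (g (f x)) x \<le> s\<^sub>1"
    "\<And>x x'. dist x x' \<le> t \<Longrightarrow> dist (f x) (f x') \<le> s\<^sub>1"
    "\<And>s. s\<^sub>1 \<le> s \<Longrightarrow> \<forall>A B. finite A \<longrightarrow> finite B \<longrightarrow> (\<forall>y\<in>B. \<forall>z. dist y z \<le> s \<longrightarrow> z \<in> B) \<longrightarrow> f ` A \<subseteq> B \<longrightarrow>
      card A \<le> card B"
    by (rule U.localisation_properties[OF d(1) f d'(1) g]) (rule that)
  obtain s\<^sub>2 where s\<^sub>2: "\<And>y. dist (f (g y)) y \<le> s\<^sub>2"
    "\<And>y y'. dist y y' \<le> t \<Longrightarrow> dist (g y) (g y') \<le> s\<^sub>2"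
    "\<And>s. s\<^sub>2 \<le> s \<Longrightarrow> \<forall>B A. finite B \<longrightarrow> finite A \<longrightarrow> (\<forall>x\<in>A. \<forall>z. dist x z \<le> s \<longrightarrow> z \<in> A) \<longrightarrow> g ` B \<subseteq> A \<longrightarrow>
      card B \<le> card A"
    by (rule V.localisation_properties[OF d'(1) g d(1) f]) (rule that)
  define s where "s = max s\<^sub>1 s\<^sub>2"
  have s: "s\<^sub>1 \<le> s" "s\<^sub>2 \<le> s" by (simp_all add: s_def)
  have "matched_pieces X Y f g s t"
  proof
    show "finite (cball x s)" for x :: 'a using cball_bound[OF assms(2)] by metis
    show "finite (cball y s)" for y :: 'b using cball_bound[OF assms(3)] by metis
    show "dist (f x) (f x') \<le> s" if "dist x x' \<le> t" for x x'
      using s\<^sub>1(2)[OF that] s(1) by (rule order.trans)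
    show "dist (g y) (g y') \<le> s" if "dist y y' \<le> t" for y y'
      using s\<^sub>2(2)[OF that] s(2) by (rule order.trans)
    show "dist (g (f x)) x \<le> s" for x using s\<^sub>1(1) s(1) by (rule order.trans)
    show "dist (f (g y)) y \<le> s" for y using s\<^sub>2(1) s(2) by (rule order.trans)
    show "card A \<le> card B" if "finite A" "finite B"
      "\<And>y z. y \<in> B \<Longrightarrow> dist y z \<le> s \<Longrightarrow> z \<in> B" "f ` A \<subseteq> B" for A B
      using s\<^sub>1(3)[OF s(1)] that by blast
    show "card B \<le> card A" if "finite B" "finite A"
      "\<And>x z. x \<in> A \<Longrightarrow> dist x z \<le> s \<Longrightarrow> z \<in> A" "g ` B \<subseteq> A" for A B
      using s\<^sub>2(3)[OF s(2)] that by blast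
  qed (use assms in blast)+
  then interpret matched_pieces X Y f g s t .
  \<comment> \<open>\<open>f\<close> selects a large entry of \<open>U (delta x)\<close> for every
    \<open>x\<close>, hence is defined on the unmatched pieces too; \<open>g\<close> is its coarse
    inverse.\<close>
  have "coarse_equivalence f"
    unfolding coarse_equivalence_def
  proof (intro conjI exI[of _ g])
    show "coarse_map f"
      by (rule coarse_mapI) (metis U.localisation_coarse[OF d(1) f])
    show "coarse_map g"
      by (rule coarse_mapI) (metis V.localisation_coarse[OF d'(1) g])
    show "close_maps (g \<circ> f) id" "close_maps (f \<circ> g) id"
      unfolding close_maps_def by (auto intro!: bdd_aboveI[of _ s] inverse)
  qed
  with matching show ?thesis by blast
qed

end
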